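(* Suppose that $A_1,\ldots,A_r\in\mathbb{R}_+^{n\times n}$ pairwise commute (under the usual matrix multiplication) and that, for each $i\in\{1,\ldots,r\}$, all classes of $A_i$ have distinct Perron roots. Then: (i) All classes of $A_1,\ldots,A_r$ and of $A_1+\cdots+A_r$ coincide. (ii) The transitive closures of the reduced digraphs of $A_1,\ldots,A_r$ and of $A_1+\cdots+A_r$ coincide. (iii) The reduced digraphs of $A_1,\ldots,A_r$ have the same premier spectral classes, which are premier spectral classes of $A_1+\cdots+A_r$. In particular, $A_1,\ldots,A_r$ have the same number of distinct distinguished eigenvalues. (iv) Let $\mu_1,\ldots,\mu_m$ be the common premier spectral classes of $A_1,\ldots,A_r$ and denote the Perron root of the $\mu_j$-th class of $A_i$ by $\alpha_i^j$. Then, for any real polynomial $p(x_1,\ldots,x_r)$ such that $p(A_1,\ldots,A_r)$ is nonnegative, the distinguished eigenvalues of $p(A_1,\ldots,A_r)$ are precisely $p(\alpha_1^j,\ldots,\alpha_r^j)$ for $j=1,\ldots,m$ (possibly with repetitions).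
   Context: Here $\mathbb{R}_+=[0,\infty)$ and all operations are the usual ones of linear algebra over $\mathbb{R}$. A distinguished eigenvalue of $A\in\mathbb{R}_+^{n\times n}$ is a real $\lambda\ge0$ for which there is a nonzero entrywise nonnegative vector $v$ with $Av=\lambda v$. The Perron root of a nonnegative matrix is its largest distinguished eigenvalue (equivalently its spectral radius). The associated digraph of $A\in\mathbb{R}_+^{n\times n}$ has node set $N=\{1,\ldots,n\}$ and an edge $(i,j)$ whenever $a_{ij}>0$. Its strongly connected components (or their node sets $N^1,\ldots,N^t$) are called the classes of $A$ (a single node lying on no cycle also forms a class). The reduced digraph of $A$ has the classes as nodes and an edge $(\mu,\nu)$ whenever there are $i\in N^\mu$, $j\in N^\nu$ with $a_{ij}>0$. Write $\mu\to\nu$ if $\mu=\nu$ or there is a path from $\mu$ to $\nu$ in the reduced digraph. The transitive closure of the reduced digraph is the digraph on the classes with edge $(\mu,\nu)$ iff $\mu\to\nu$. The Perron root $\alpha_\mu$ of a class $\mu$ is the Perron root of the submatrix of $A$ with rows and columns in $N^\mu$. A class $\nu$ is initial if $\mu\to\nu$ implies $\mu=\nu$. A class $\nu$ is spectral if $\nu$ is initial, or if $\alpha_\nu>0$ and $\mu\to\nu$ implies $\alpha_\mu\le\alpha_\nu$. A spectral class $\nu$ is premier spectral if $\mu\to\nu$ and $\mu\ne\nu$ imply $\alpha_\mu<\alpha_\nu$. *)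

theory Defs
  imports
    "HOL-Analysis.Analysis"
    "HOL-Library.Poly_Mapping"
    "Graph_Theory.Graph_Theory"
begin

section \<open>Nonnegative matrices and distinguished eigenvalues\<close>

definition nonneg_matrix :: "real^'n^'n \<Rightarrow> bool" where
  "nonneg_matrix A \<longleftrightarrow> (\<forall>i j. 0 \<le> A $ i $ j)"

definition distinguished_eigenvalue :: "real^'n^'n \<Rightarrow> real \<Rightarrow> bool" where
  "distinguished_eigenvalue A \<rho> \<longleftrightarrow>
     0 \<le> \<rho> \<and> (\<exists>v. v \<noteq> 0 \<and> (\<forall>i. 0 \<le> v $ i) \<and> A *v v = \<rho> *s v)"

text \<open>The same notion for the principal submatrix of \<open>A\<close> with rows and columns in \<open>S\<close>.
  Its vectors are the functions on \<open>S\<close>: values of \<open>v\<close> outside \<open>S\<close> are irrelevant.\<close>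

definition distinguished_eigenvalue_on :: "'n set \<Rightarrow> real^'n^'n \<Rightarrow> real \<Rightarrow> bool" where
  "distinguished_eigenvalue_on S A \<rho> \<longleftrightarrow>
     0 \<le> \<rho> \<and> (\<exists>v :: 'n \<Rightarrow> real. (\<exists>i\<in>S. v i \<noteq> 0) \<and> (\<forall>i\<in>S. 0 \<le> v i) \<and>
       (\<forall>i\<in>S. (\<Sum>j\<in>S. A $ i $ j * v j) = \<rho> * v i))"

lemma distinguished_eigenvalue_on_UNIV:
  "distinguished_eigenvalue_on UNIV A \<rho> \<longleftrightarrow> distinguished_eigenvalue A \<rho>"
proof -
  have "(\<exists>v :: 'a \<Rightarrow> real. (\<exists>i. v i \<noteq> 0) \<and> (\<forall>i. 0 \<le> v i) \<and>
           (\<forall>i. (\<Sum>j\<in>UNIV. A $ i $ j * v j) = \<rho> * v i)) \<longleftrightarrow>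
        (\<exists>w :: real^'a. w \<noteq> 0 \<and> (\<forall>i. 0 \<le> w $ i) \<and> A *v w = \<rho> *s w)" (is "?L \<longleftrightarrow> ?R")
  proof
    assume ?L
    then obtain v where "\<exists>i. v i \<noteq> 0" "\<forall>i. 0 \<le> v i"
      "\<forall>i. (\<Sum>j\<in>UNIV. A $ i $ j * v j) = \<rho> * v i" by blast
    then show ?R
      by (intro exI[of _ "\<chi> i. v i"]) (simp add: vec_eq_iff matrix_vector_mult_def)
  next
    assume ?R
    then obtain w where "w \<noteq> 0" "\<forall>i. 0 \<le> w $ i" "A *v w = \<rho> *s w" by blast
    then show ?L
      by (intro exI[of _ "\<lambda>i. w $ i"]) (simp add: vec_eq_iff matrix_vector_mult_def)
  qed
  then show ?thesis
    by (simp add: distinguished_eigenvalue_on_def distinguished_eigenvalue_def)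
qed

definition perron_root_on :: "'n set \<Rightarrow> real^'n^'n \<Rightarrow> real" where
  "perron_root_on S A = (GREATEST \<rho>. distinguished_eigenvalue_on S A \<rho>)"

lemma eigenvectors_independent:
  fixes A :: "real^'n^'n"
  assumes "finite L" and "\<And>l. l \<in> L \<Longrightarrow> v l \<noteq> 0 \<and> A *v v l = l *s v l"
    and "(\<Sum>l\<in>L. c l *s v l) = 0"
  shows "\<forall>l\<in>L. c l = 0"
  using assms
proof (induction L arbitrary: c rule: finite_induct)
  case empty
  then show ?case by simp
next
  case (insert a L)
  have lin: "A *v (\<Sum>l\<in>insert a L. c l *s v l) = (\<Sum>l\<in>insert a L. (c l * l) *s v l)"
    using insert.prems(1)
    unfolding linear_sum[OF matrix_vector_mul_linear, of A]
    by (intro sum.cong refl) (simp add: vector_scalar_commute vector_smult_assoc)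
  have "(\<Sum>l\<in>L. (c l * (l - a)) *s v l)
      = (\<Sum>l\<in>insert a L. (c l * l) *s v l) - a *s (\<Sum>l\<in>insert a L. c l *s v l)"
    using insert.hyps
    by (simp add: algebra_simps vec_eq_iff sum_distrib_left sum_subtractf)
  also have "\<dots> = 0"
    using lin insert.prems(2) by simp
  finally have "\<forall>l\<in>L. c l * (l - a) = 0"
    using insert.IH[of "\<lambda>l. c l * (l - a)"] insert.prems(1) by blast
  then have *: "\<forall>l\<in>L. c l = 0"
    using insert.hyps by auto
  then have "c a *s v a = 0"
    using insert.prems(2) insert.hyps by simp
  then show ?case
    using * insert.prems(1)[of a] by (auto simp: vec_eq_iff)
qed

lemma finite_distinguished_eigenvalues:
  fixes A :: "real^'n^'n"
  shows "finite {\<rho>. distinguished_eigenvalue A \<rho>}"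
proof (rule ccontr)
  assume "infinite {\<rho>. distinguished_eigenvalue A \<rho>}"
  then obtain L where L: "L \<subseteq> {\<rho>. distinguished_eigenvalue A \<rho>}" "finite L"
      "card L = Suc (DIM(real^'n))"
    using infinite_arbitrarily_large by metis
  then have "\<forall>l\<in>L. \<exists>v. v \<noteq> 0 \<and> A *v v = l *s v"
    by (auto simp: distinguished_eigenvalue_def)
  then obtain v where v: "\<And>l. l \<in> L \<Longrightarrow> v l \<noteq> 0 \<and> A *v v l = l *s v l"
    by metis
  have indep: "\<forall>l\<in>L. c l = 0" if "(\<Sum>l\<in>L. c l *s v l) = 0" for c
    using eigenvectors_independent[OF L(2) v that] .
  have inj: "inj_on v L"
  proof (rule inj_onI)
    fix a b assume ab: "a \<in> L" "b \<in> L" "v a = v b"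
    then have "a *s v a = b *s v a"
      using v by metis
    then have "(a - b) *s v a = 0"
      by (simp add: vec_eq_iff algebra_simps)
    then show "a = b"
      using v[OF ab(1)] by (auto simp: vec_eq_iff)
  qed
  have "independent (v ` L)"
  proof (rule independent_if_scalars_zero)
    show "finite (v ` L)" using L(2) by simp
    fix f x assume f: "(\<Sum>x\<in>v ` L. f x *\<^sub>R x) = 0" and x: "x \<in> v ` L"
    have "(\<Sum>l\<in>L. f (v l) *s v l) = 0"
      using f by (simp add: sum.reindex[OF inj] scalar_mult_eq_scaleR)
    from indep[OF this] x show "f x = 0" by auto
  qed
  then have "card (v ` L) \<le> DIM(real^'n)"
    using independent_bound by blast
  then show False
    using L(3) card_image[OF inj] by simp
qed

section \<open>Digraphs and classes of a matrix\<close>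

definition associated_digraph :: "real^'n^'n \<Rightarrow> 'n pair_pre_digraph" where
  "associated_digraph A = \<lparr> pverts = UNIV, parcs = {(i, j). 0 < A $ i $ j} \<rparr>"

definition classes :: "real^'n^'n \<Rightarrow> 'n set set" where
  "classes A = pre_digraph.sccs_verts (with_proj (associated_digraph A))"

definition class_perron_root :: "real^'n^'n \<Rightarrow> 'n set \<Rightarrow> real" where
  "class_perron_root A \<mu> = perron_root_on \<mu> A"

definition reduced_digraph :: "real^'n^'n \<Rightarrow> 'n set pair_pre_digraph" where
  "reduced_digraph A =
     \<lparr> pverts = classes A,
       parcs = {(\<mu>, \<nu>). \<mu> \<in> classes A \<and> \<nu> \<in> classes A \<and> (\<exists>i\<in>\<mu>. \<exists>j\<in>\<nu>. 0 < A $ i $ j)} \<rparr>"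

text \<open>Reachability in the library is reflexive on the vertices, so every class accesses itself.\<close>

definition accesses :: "real^'n^'n \<Rightarrow> 'n set \<Rightarrow> 'n set \<Rightarrow> bool" where
  "accesses A \<mu> \<nu> \<longleftrightarrow> \<mu> \<rightarrow>\<^sup>*\<^bsub>with_proj (reduced_digraph A)\<^esub> \<nu>"

definition reduced_closure :: "real^'n^'n \<Rightarrow> 'n set pair_pre_digraph" where
  "reduced_closure A = \<lparr> pverts = classes A, parcs = {(\<mu>, \<nu>). accesses A \<mu> \<nu>} \<rparr>"

definition initial_class :: "real^'n^'n \<Rightarrow> 'n set \<Rightarrow> bool" where
  "initial_class A \<nu> \<longleftrightarrow> \<nu> \<in> classes A \<and> (\<forall>\<mu>\<in>classes A. accesses A \<mu> \<nu> \<longrightarrow> \<mu> = \<nu>)"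

definition spectral_class :: "real^'n^'n \<Rightarrow> 'n set \<Rightarrow> bool" where
  "spectral_class A \<nu> \<longleftrightarrow> \<nu> \<in> classes A \<and>
     (initial_class A \<nu> \<or>
      (0 < class_perron_root A \<nu> \<and>
       (\<forall>\<mu>\<in>classes A. accesses A \<mu> \<nu> \<longrightarrow> class_perron_root A \<mu> \<le> class_perron_root A \<nu>)))"

definition premier_spectral_classes :: "real^'n^'n \<Rightarrow> 'n set set" where
  "premier_spectral_classes A = {\<nu>. spectral_class A \<nu> \<and>
     (\<forall>\<mu>\<in>classes A. accesses A \<mu> \<nu> \<and> \<mu> \<noteq> \<nu> \<longrightarrow> class_perron_root A \<mu> < class_perron_root A \<nu>)}"

section \<open>Real polynomials in several variables and their values\<close>

text \<open>A monomial is the finitely supported map sending the index of a variable to its exponent;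
  a polynomial is the finitely supported map sending a monomial to its coefficient.\<close>

type_synonym real_mpoly = "(nat \<Rightarrow>\<^sub>0 nat) \<Rightarrow>\<^sub>0 real"

definition polynomial_in :: "nat \<Rightarrow> real_mpoly \<Rightarrow> bool" where
  "polynomial_in r p \<longleftrightarrow> (\<forall>m\<in>Poly_Mapping.keys p. Poly_Mapping.keys m \<subseteq> {1..r})"

definition poly_value :: "nat \<Rightarrow> real_mpoly \<Rightarrow> (nat \<Rightarrow> real) \<Rightarrow> real" where
  "poly_value r p x = (\<Sum>m\<in>Poly_Mapping.keys p.
     Poly_Mapping.lookup p m * (\<Prod>i\<in>{1..r}. x i ^ Poly_Mapping.lookup m i))"

text \<open>The type \<open>real^'n^'n\<close> carries a pointwise \<open>*\<close>, so powers have to be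
  iterated from \<open>**\<close>.\<close>

definition matrix_power :: "real^'n^'n \<Rightarrow> nat \<Rightarrow> real^'n^'n" where
  "matrix_power A k = (((**) A) ^^ k) (mat 1)"

text \<open>The product \<open>A 1 ^ e 1 ** \<dots> ** A r ^ e r\<close>. The order of the factors only matters if the
  matrices do not commute.\<close>

definition matrix_monomial :: "nat \<Rightarrow> (nat \<Rightarrow>\<^sub>0 nat) \<Rightarrow> (nat \<Rightarrow> real^'n^'n) \<Rightarrow> real^'n^'n" where
  "matrix_monomial r m A =
     foldr (\<lambda>i M. matrix_power (A i) (Poly_Mapping.lookup m i) ** M) [1..<Suc r] (mat 1)"

definition poly_matrix :: "nat \<Rightarrow> real_mpoly \<Rightarrow> (nat \<Rightarrow> real^'n^'n) \<Rightarrow> real^'n^'n" where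
  "poly_matrix r p A =
     (\<Sum>m\<in>Poly_Mapping.keys p. Poly_Mapping.lookup p m *\<^sub>R matrix_monomial r m A)"

end

theory Submission
  imports Defs
begin

text \<open>
  The paths in the digraph of \<open>A\<close> define a preorder on the nodes, in which \<open>i\<close> comes before \<open>j\<close> if
  there is a path from \<open>i\<close> to \<open>j\<close>. The classes of \<open>A\<close> and the transitive closure of its reduced
  digraph carry the same information as this preorder (\<open>classes_eq_range\<close>, \<open>accesses_iff\<close>), so equality of both for all the matrices
  means that they have the same preorder.

  If \<open>A\<close> has distinct class roots and \<open>B \<ge> 0\<close> commutes with \<open>A\<close>, then every arc of \<open>B\<close> is a path
  of \<open>A\<close> (\<open>commuting_arc_reaches\<close>). Otherwise choose an arc \<open>(s, t)\<close> of \<open>B\<close> that is no path of \<open>A\<close>,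
  with \<open>s\<close> as late and \<open>t\<close> as early as possible in the preorder of \<open>A\<close>. For the classes \<open>\<mu>\<close> of
  \<open>s\<close> and \<open>\<nu>\<close> of \<open>t\<close> the equation \<open>A B = B A\<close> then reads \<open>A[\<mu>,\<mu>] B[\<mu>,\<nu>] = B[\<mu>,\<nu>] A[\<nu>,\<nu>]\<close>, because
  all other summands would contain an arc of \<open>B\<close> that is excluded by the choice. Hence \<open>B[\<mu>,\<nu>]\<close>
  maps a Perron vector of \<open>\<nu>\<close> to a nonnegative eigenvector of \<open>\<mu>\<close> for the root of \<open>\<nu>\<close>. An
  irreducible block has only one nonnegative eigenvalue with a nonnegative eigenvector, so the
  two roots agree and \<open>\<mu> = \<nu>\<close>, a contradiction. Applied to \<open>A i\<close>
  and the sum, whose arcs are those of all the \<open>A i\<close>, this gives one common preorder.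

  The link between classes and eigenvectors is the Frobenius-Victory theorem. A
  nonnegative eigenvector of a matrix with distinct class roots is supported exactly on the nodes
  with access to one premier spectral class, whose root is the eigenvalue
  (\<open>nonneg_eigenvector_premier\<close>); it is unique up to a factor (\<open>nonneg_eigenvector_unique\<close>), and
  every premier spectral class arises in this way (\<open>premier_class_eigenvector\<close>). By uniqueness
  such a vector is an eigenvector of every nonnegative matrix \<open>B\<close> that commutes with \<open>A\<close>. Its
  support is the same for \<open>A\<close> and \<open>B\<close>, because the preorders agree, and a nonnegative vector
  with such a support shows that the class is premier spectral for \<open>B\<close>
  (\<open>premier_if_support_is_access_set\<close>). Here \<open>B\<close> can be one of the matrices \<open>A i\<close> or their sum.

  For a polynomial \<open>p\<close>, the common eigenvectors show that the values of \<open>p\<close> at the roots of a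
  premier spectral class are distinguished eigenvalues of \<open>p(A 1, \<dots>, A r)\<close>.
  Conversely, the nonnegative eigenvectors of \<open>p(A 1, \<dots>, A r)\<close> for a given eigenvalue form a
  closed convex cone that each \<open>A i\<close> maps into itself. Brouwer's fixed point theorem yields an
  eigenvector of \<open>A i\<close> in this cone (\<open>invariant_cone_eigenvector\<close>), and it belongs to a premier
  spectral class. The same consequence of Brouwer's theorem gives the Perron vectors of a class.
\<close>

section \<open>Accessibility between nodes\<close>

definition reaches :: "real^'n^'n \<Rightarrow> 'n \<Rightarrow> 'n \<Rightarrow> bool" where
  "reaches A i j \<longleftrightarrow> (i, j) \<in> {(i, j). 0 < A $ i $ j}\<^sup>*"

definition class_of :: "real^'n^'n \<Rightarrow> 'n \<Rightarrow> 'n set" where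
  "class_of A i = {j. reaches A i j \<and> reaches A j i}"

definition node_root :: "real^'n^'n \<Rightarrow> 'n \<Rightarrow> real" where
  "node_root A i = class_perron_root A (class_of A i)"

lemma reaches_refl [simp]: "reaches A i i"
  by (simp add: reaches_def)

lemma reaches_trans [trans]: "reaches A i j \<Longrightarrow> reaches A j k \<Longrightarrow> reaches A i k"
  unfolding reaches_def by (rule rtrancl_trans)

lemma reaches_arc: "0 < A $ i $ j \<Longrightarrow> reaches A i j"
  unfolding reaches_def by auto

lemma reaches_converse_induct [consumes 1, case_names base step]:
  assumes "reaches A i j" and "P j"
    and "\<And>i k. 0 < A $ i $ k \<Longrightarrow> reaches A k j \<Longrightarrow> P k \<Longrightarrow> P i"
  shows "P i"
  using assms(1) unfolding reaches_def
proof (induction rule: converse_rtrancl_induct)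
  case base
  show ?case by (rule assms(2))
next
  case (step i k)
  then show ?case using assms(3)[of i k] by (simp add: reaches_def)
qed

lemma reaches_transpose: "reaches (transpose A) i j \<longleftrightarrow> reaches A j i"
proof -
  have "{(i, j). 0 < transpose A $ i $ j} = {(i, j). 0 < A $ i $ j}\<inverse>"
    by (auto simp: transpose_def)
  then show ?thesis
    unfolding reaches_def by (simp add: rtrancl_converse)
qed

lemma class_of_transpose: "class_of (transpose A) i = class_of A i"
  by (auto simp: class_of_def reaches_transpose)

lemma class_of_self [simp]: "i \<in> class_of A i"
  by (simp add: class_of_def)

lemma class_of_eq_iff: "class_of A i = class_of A j \<longleftrightarrow> reaches A i j \<and> reaches A j i"
  unfolding class_of_def set_eq_iff mem_Collect_eq
  by (meson reaches_refl reaches_trans)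

lemma class_of_eq: "j \<in> class_of A i \<Longrightarrow> class_of A j = class_of A i"
  unfolding class_of_eq_iff by (simp add: class_of_def)

text \<open>The library restricts reachability to the vertices of the digraph; here every node is a vertex.\<close>

lemma reachable_associated_digraph:
  "i \<rightarrow>\<^sup>*\<^bsub>with_proj (associated_digraph A)\<^esub> j \<longleftrightarrow> reaches A i j"
proof -
  have "rtrancl_on UNIV R = R\<^sup>*" for R :: "('a \<times> 'a) set"
  proof (intro set_eqI iffI; clarify)
    fix a b assume "(a, b) \<in> rtrancl_on UNIV R" then show "(a, b) \<in> R\<^sup>*"
      by (rule rtrancl_on_rtranclI)
  next
    fix a b assume "(a, b) \<in> R\<^sup>*" then show "(a, b) \<in> rtrancl_on UNIV R"
      by (induction rule: rtrancl_induct) (auto intro: rtrancl_on_into_rtrancl_on)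
  qed
  then show ?thesis
    by (simp add: reachable_def associated_digraph_def reaches_def)
qed

lemma classes_eq_range: "classes A = range (class_of A)"
proof (intro set_eqI iffI)
  fix S assume "S \<in> classes A"
  then have S: "S \<noteq> {}" "\<And>u v. u \<in> S \<Longrightarrow> v \<in> S \<Longrightarrow> reaches A u v"
      "\<And>u v. u \<in> S \<Longrightarrow> v \<notin> S \<Longrightarrow> \<not> reaches A u v \<or> \<not> reaches A v u"
    by (auto simp: classes_def pre_digraph.sccs_verts_def reachable_associated_digraph)
  then obtain i where "i \<in> S" by blast
  then have "S = class_of A i"
    using S(2,3) unfolding class_of_def by blast
  then show "S \<in> range (class_of A)" by blast
next
  fix S assume "S \<in> range (class_of A)"
  then obtain i where S: "S = class_of A i" by blast
  show "S \<in> classes A"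
    unfolding classes_def pre_digraph.sccs_verts_def reachable_associated_digraph S
    by (auto simp: class_of_def intro: reaches_trans exI[of _ i])
qed

lemma accesses_iff:
  "accesses A \<mu> \<nu> \<longleftrightarrow> (\<exists>i j. \<mu> = class_of A i \<and> \<nu> = class_of A j \<and> reaches A i j)"
proof
  let ?R = "parcs (reduced_digraph A)"
  assume "accesses A \<mu> \<nu>"
  then have "(\<mu>, \<nu>) \<in> rtrancl_on (classes A) ?R"
    by (simp add: accesses_def reachable_def reduced_digraph_def)
  then show "\<exists>i j. \<mu> = class_of A i \<and> \<nu> = class_of A j \<and> reaches A i j"
  proof (induction rule: rtrancl_on.induct)
    case (rtrancl_on_refl \<mu>)
    then obtain i where "\<mu> = class_of A i" by (auto simp: classes_eq_range)
    then show ?case using reaches_refl by blast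
  next
    case (rtrancl_on_into_rtrancl_on \<mu> \<kappa> \<nu>)
    then obtain i j k l m where *: "\<mu> = class_of A i" "\<kappa> = class_of A j" "reaches A i j"
      "k \<in> class_of A j" "l \<in> \<nu>" "0 < A $ k $ l" "\<nu> = class_of A m"
      by (auto simp: reduced_digraph_def classes_eq_range)
    then have "\<nu> = class_of A l" using class_of_eq by metis
    moreover have "reaches A i l"
      using * reaches_arc[OF *(6)] unfolding class_of_def by (blast intro: reaches_trans)
    ultimately show ?case using * by blast
  qed
next
  assume "\<exists>i j. \<mu> = class_of A i \<and> \<nu> = class_of A j \<and> reaches A i j"
  then obtain i j where ij: "\<mu> = class_of A i" "\<nu> = class_of A j" "reaches A i j" by blast
  from ij(3) have "accesses A (class_of A i) (class_of A j)"
  proof (induction rule: reaches_converse_induct)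
    case base
    then show ?case
      by (simp add: accesses_def reachable_def reduced_digraph_def classes_eq_range)
  next
    case (step i k)
    have "class_of A i \<in> classes A" "class_of A k \<in> classes A"
      by (auto simp: classes_eq_range)
    moreover have "\<exists>i'\<in>class_of A i. \<exists>k'\<in>class_of A k. 0 < A $ i' $ k'"
      using step.hyps(1) class_of_self by blast
    ultimately show ?case
      using step.IH unfolding accesses_def reachable_def
      by (auto simp: reduced_digraph_def intro: converse_rtrancl_on_into_rtrancl_on)
  qed
  then show "accesses A \<mu> \<nu>" using ij by simp
qed

lemma same_reaches_same_closure:
  assumes "reaches A = reaches B"
  shows "class_of A = class_of B" "classes A = classes B" "reduced_closure A = reduced_closure B"
proof -
  show *: "class_of A = class_of B"
    using assms by (auto simp: class_of_def fun_eq_iff)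
  then show **: "classes A = classes B" by (simp add: classes_eq_range)
  have "accesses A = accesses B"
    using assms * by (simp add: fun_eq_iff accesses_iff)
  then show "reduced_closure A = reduced_closure B"
    using ** by (simp add: reduced_closure_def)
qed

lemma accesses_class_of: "accesses A (class_of A i) (class_of A j) \<longleftrightarrow> reaches A i j"
  unfolding accesses_iff class_of_eq_iff by (meson reaches_refl reaches_trans)

text \<open>A node that can be left for good reaches more nodes than the node to which it leads. This
  cardinality, and its mirror image in the next lemma, measure how late a node comes in the
  preorder, so that extremal nodes can be chosen by minimisation.\<close>

lemma card_reaches_less:
  fixes A :: "real^'n^'n"
  assumes "reaches A i k" "\<not> reaches A k i"
  shows "card {l. reaches A k l} < card {l. reaches A i l}"
proof (rule psubset_card_mono)
  show "{l. reaches A k l} \<subset> {l. reaches A i l}"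
    using assms by (auto intro: reaches_trans)
qed simp

lemma card_reached_less:
  fixes A :: "real^'n^'n"
  assumes "reaches A k j" "\<not> reaches A j k"
  shows "card {l. reaches A l k} < card {l. reaches A l j}"
proof (rule psubset_card_mono)
  show "{l. reaches A l k} \<subset> {l. reaches A l j}"
    using assms by (auto intro: reaches_trans)
qed simp

text \<open>Applied to the support of a vector, this gives a class whose rows see no other part of the
  support, so that on this class the full matrix acts as its diagonal block.\<close>

lemma last_node_exists:
  fixes A :: "real^'n^'n"
  assumes "S \<noteq> {}"
  shows "\<exists>i\<in>S. \<forall>k\<in>S. reaches A i k \<longrightarrow> reaches A k i"
proof -
  obtain i where i: "is_arg_min (\<lambda>i. card {l. reaches A i l}) (\<lambda>i. i \<in> S) i"
    using ex_is_arg_min_if_finite[OF _ assms, of "\<lambda>i. card {l. reaches A i l}"] by auto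
  show ?thesis
  proof (intro bexI ballI impI)
    show "i \<in> S" using i by (simp add: is_arg_min_def)
    fix k assume "k \<in> S" "reaches A i k"
    then show "reaches A k i"
      using i card_reaches_less[of A i k] by (auto simp: is_arg_min_def)
  qed
qed

section \<open>Eigenvectors in invariant cones\<close>

lemma matrix_vector_mult_nonneg:
  assumes "nonneg_matrix A" "\<And>i. 0 \<le> x $ i"
  shows "0 \<le> (A *v x) $ i"
  using assms by (simp add: matrix_vector_mult_def nonneg_matrix_def sum_nonneg)

text \<open>The slice of the cone by the coordinate sum \<open>1\<close> is compact and convex. With \<open>\<sigma>\<close> for the
  coordinate sum, \<open>x \<mapsto> (x + A x) / \<sigma> (x + A x)\<close> maps it into itself, so Brouwer's theorem applies. The
  summand \<open>x\<close> keeps the denominator at least \<open>1\<close>, also where \<open>A x = 0\<close>.\<close>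

lemma invariant_cone_eigenvector:
  fixes A :: "real^'n^'n" and K :: "(real^'n) set"
  assumes "closed K" and add: "\<And>x y. x \<in> K \<Longrightarrow> y \<in> K \<Longrightarrow> x + y \<in> K"
    and scale: "\<And>c x. 0 \<le> c \<Longrightarrow> x \<in> K \<Longrightarrow> c *s x \<in> K"
    and nonneg: "\<And>x i. x \<in> K \<Longrightarrow> 0 \<le> x $ i"
    and inv: "\<And>x. x \<in> K \<Longrightarrow> A *v x \<in> K"
    and z: "z \<in> K" "z \<noteq> 0"
  obtains v l where "v \<in> K" "v \<noteq> 0" "0 \<le> l" "A *v v = l *s v"
proof -
  define \<sigma> :: "real^'n \<Rightarrow> real" where "\<sigma> x = (\<Sum>i\<in>UNIV. x $ i)" for x
  define D where "D = {x \<in> K. \<sigma> x = 1}"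
  define g where "g x = x + A *v x" for x
  define f where "f x = (1 / \<sigma> (g x)) *s g x" for x
  have \<sigma>_lin: "\<sigma> (x + y) = \<sigma> x + \<sigma> y" "\<sigma> (c *s x) = c * \<sigma> x" for x y c
    by (simp_all add: \<sigma>_def sum.distrib sum_distrib_left)
  have \<sigma>_nonneg: "0 \<le> \<sigma> x" if "x \<in> K" for x
    unfolding \<sigma>_def by (intro sum_nonneg nonneg that)
  have cont_\<sigma>: "continuous_on X \<sigma>" for X
    unfolding \<sigma>_def by (intro continuous_intros)
  have cont_g: "continuous_on X g" for X
    unfolding g_def
    by (intro continuous_intros linear_continuous_on matrix_vector_mul_bounded_linear)
  have D_eq: "D = K \<inter> {x. \<sigma> x = 1}" by (auto simp: D_def)
  have "closed {x. \<sigma> x = 1}"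
    by (intro closed_Collect_eq cont_\<sigma> continuous_on_const)
  then have "closed D" unfolding D_eq using \<open>closed K\<close> by blast
  moreover have "D \<subseteq> cbox 0 1"
  proof
    fix x assume x: "x \<in> D"
    then have "x \<in> K" "\<sigma> x = 1" by (auto simp: D_def)
    have "x $ i \<le> 1" for i
    proof -
      have "x $ i \<le> \<sigma> x"
        unfolding \<sigma>_def by (rule member_le_sum) (auto intro: nonneg \<open>x \<in> K\<close>)
      then show ?thesis using \<open>\<sigma> x = 1\<close> by simp
    qed
    then show "x \<in> cbox 0 1"
      using nonneg[OF \<open>x \<in> K\<close>] by (simp add: mem_box_cart)
  qed
  then have "bounded D" using bounded_cbox bounded_subset by blast
  ultimately have "compact D" by (simp add: compact_eq_bounded_closed)
  moreover have "convex D"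
    unfolding convex_def D_def using add scale
    by (auto simp: \<sigma>_lin scalar_mult_eq_scaleR[symmetric])
  moreover have "D \<noteq> {}"
  proof -
    obtain i where "z $ i \<noteq> 0" using z(2) by (auto simp: vec_eq_iff)
    then have "0 < z $ i" using nonneg[OF z(1), of i] by simp
    also have "z $ i \<le> \<sigma> z"
      unfolding \<sigma>_def by (rule member_le_sum) (auto intro: nonneg z)
    finally have "(1 / \<sigma> z) *s z \<in> D"
      using scale z(1) by (simp add: D_def \<sigma>_lin)
    then show ?thesis by blast
  qed
  moreover have g: "g x \<in> K" "1 \<le> \<sigma> (g x)" if "x \<in> D" for x
    using that inv[of x] add \<sigma>_nonneg[of "A *v x"] by (auto simp: D_def g_def \<sigma>_lin)
  have "continuous_on D f"
    unfolding f_def scalar_mult_eq_scaleR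
    using g(2) by (intro continuous_intros cont_g continuous_on_compose2[OF cont_\<sigma>[of UNIV]]) force+
  moreover have "f ` D \<subseteq> D"
  proof
    fix y assume "y \<in> f ` D"
    then obtain x where x: "x \<in> D" "y = f x" by blast
    then show "y \<in> D"
      using g[OF x(1)] scale by (simp add: D_def f_def \<sigma>_lin)
  qed
  ultimately obtain v where v: "v \<in> D" "f v = v"
    using brouwer by blast
  define c where "c = \<sigma> (g v)"
  have "1 \<le> c" using g(2)[OF v(1)] by (simp add: c_def)
  have "g v = c *s f v"
    using \<open>1 \<le> c\<close> by (simp add: f_def c_def)
  then have "g v = c *s v"
    using v(2) by simp
  then have "A *v v = (c - 1) *s v"
    by (simp add: g_def vec_eq_iff algebra_simps)
  moreover have "v \<noteq> 0"
    using v(1) by (auto simp: D_def \<sigma>_def)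
  ultimately show thesis
    using that[of v "c - 1"] v(1) \<open>1 \<le> c\<close> by (auto simp: D_def)
qed

section \<open>Perron vectors of a class\<close>

text \<open>The cone is the set of nonnegative vectors that vanish outside \<open>S\<close>. It is invariant under the
  matrix in which all entries outside the block have been replaced by zero.\<close>

lemma distinguished_eigenvalue_on_exists:
  fixes A :: "real^'n^'n"
  assumes "nonneg_matrix A" "S \<noteq> {}"
  obtains \<rho> where "distinguished_eigenvalue_on S A \<rho>"
proof -
  define B :: "real^'n^'n" where "B = (\<chi> i j. if i \<in> S \<and> j \<in> S then A $ i $ j else 0)"
  define K where "K = {x :: real^'n. \<forall>i. 0 \<le> x $ i \<and> (i \<notin> S \<longrightarrow> x $ i = 0)}"
  have B: "nonneg_matrix B"
    using assms(1) by (simp add: nonneg_matrix_def B_def)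
  have cl: "closed K"
    unfolding K_def
    by (intro closed_Collect_all closed_Collect_conj closed_Collect_imp open_Collect_const
        closed_Collect_le closed_Collect_eq continuous_intros)
  have add: "x + y \<in> K" if "x \<in> K" "y \<in> K" for x y
    using that by (simp add: K_def)
  have scale: "c *s x \<in> K" if "0 \<le> c" "x \<in> K" for c x
    using that by (simp add: K_def)
  have nonneg: "0 \<le> x $ i" if "x \<in> K" for x i
    using that by (simp add: K_def)
  have inv: "B *v x \<in> K" if "x \<in> K" for x
    using that matrix_vector_mult_nonneg[OF B, of x]
    by (simp add: K_def) (simp add: matrix_vector_mult_def B_def)
  have z: "(\<chi> i. if i \<in> S then 1 else 0) \<in> K" "(\<chi> i. if i \<in> S then 1 else 0) \<noteq> (0 :: real^'n)"
    using assms(2) by (auto simp: K_def vec_eq_iff)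
  obtain v l where v: "v \<in> K" "v \<noteq> 0" "0 \<le> l" "B *v v = l *s v"
    using invariant_cone_eigenvector[OF cl add scale nonneg inv z] by blast
  have "(\<Sum>j\<in>S. A $ i $ j * v $ j) = l * v $ i" if "i \<in> S" for i
  proof -
    have "(\<Sum>j\<in>S. A $ i $ j * v $ j) = (\<Sum>j\<in>UNIV. B $ i $ j * v $ j)"
      using that by (intro sum.mono_neutral_cong_left) (auto simp: B_def)
    also have "\<dots> = l * v $ i"
      using v(4) by (simp add: vec_eq_iff matrix_vector_mult_def)
    finally show ?thesis .
  qed
  moreover have "\<exists>i\<in>S. v $ i \<noteq> 0"
    using v(1,2) by (auto simp: K_def vec_eq_iff)
  ultimately have "distinguished_eigenvalue_on S A l"
    unfolding distinguished_eigenvalue_on_def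
    using v(1,3) by (intro conjI exI[of _ "\<lambda>i. v $ i"]) (auto simp: K_def)
  then show thesis by (rule that)
qed

lemma distinguished_eigenvalue_onE:
  fixes A :: "real^'n^'n"
  assumes "distinguished_eigenvalue_on S A \<rho>"
  obtains j v where "0 \<le> \<rho>" "j \<in> S" "v j \<noteq> 0" "\<And>i. i \<in> S \<Longrightarrow> 0 \<le> v i"
    "\<And>i. i \<in> S \<Longrightarrow> (\<Sum>j\<in>S. A $ i $ j * v j) = \<rho> * v i"
  using assms unfolding distinguished_eigenvalue_on_def
proof (elim conjE exE bexE)
  fix v j
  assume "0 \<le> \<rho>" "j \<in> S" "v j \<noteq> 0" "\<forall>i\<in>S. 0 \<le> v i"
    "\<forall>i\<in>S. (\<Sum>j\<in>S. A $ i $ j * v j) = \<rho> * v i"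
  then show thesis by (intro that[of j v]) auto
qed

text \<open>If \<open>v k > 0\<close> and \<open>(i, k)\<close> is an arc, then \<open>0 < A\<^sub>i\<^sub>k v\<^sub>k \<le> \<rho> v\<^sub>i\<close>. Positivity thus spreads backwards
  along paths, and within a class every node has a path to every other.\<close>

lemma class_eigenvector_positive:
  fixes A :: "real^'n^'n"
  assumes A: "nonneg_matrix A"
    and nonneg: "\<And>i. i \<in> class_of A c \<Longrightarrow> 0 \<le> v i"
    and eigen: "\<And>i. i \<in> class_of A c \<Longrightarrow> (\<Sum>j\<in>class_of A c. A $ i $ j * v j) = \<rho> * v i"
    and j: "j \<in> class_of A c" "v j \<noteq> 0" and i: "i \<in> class_of A c"
  shows "0 < v i"
proof -
  have "reaches A i j"
    using i j unfolding class_of_def by (blast intro: reaches_trans)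
  then show ?thesis
    using i
  proof (induction rule: reaches_converse_induct)
    case base
    show ?case using nonneg[OF j(1)] j(2) by simp
  next
    case (step i k)
    have k: "k \<in> class_of A c"
      using step.hyps step.prems j(1) reaches_arc[OF step.hyps(1)]
      unfolding class_of_def by (blast intro: reaches_trans)
    have "0 < A $ i $ k * v k"
      using step.hyps(1) step.IH[OF k] by simp
    also have "\<dots> \<le> (\<Sum>j\<in>class_of A c. A $ i $ j * v j)"
      using A nonneg by (intro member_le_sum[OF k]) (auto simp: nonneg_matrix_def)
    also have "\<dots> = \<rho> * v i" by (rule eigen[OF step.prems])
    finally show ?case
      using nonneg[OF step.prems] by (cases "v i = 0") auto
  qed
qed

lemma class_positive_eigenvector:
  fixes A :: "real^'n^'n"
  assumes "nonneg_matrix A"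
  obtains \<rho> v where "0 \<le> \<rho>" "\<And>i. i \<in> class_of A c \<Longrightarrow> 0 < v i"
    "\<And>i. i \<in> class_of A c \<Longrightarrow> (\<Sum>j\<in>class_of A c. A $ i $ j * v j) = \<rho> * v i"
proof -
  have "class_of A c \<noteq> {}" using class_of_self by blast
  then obtain \<rho> where "distinguished_eigenvalue_on (class_of A c) A \<rho>"
    using distinguished_eigenvalue_on_exists[OF assms] by blast
  then obtain v j where v: "0 \<le> \<rho>" "j \<in> class_of A c" "v j \<noteq> 0"
    "\<And>i. i \<in> class_of A c \<Longrightarrow> 0 \<le> v i"
    "\<And>i. i \<in> class_of A c \<Longrightarrow> (\<Sum>j\<in>class_of A c. A $ i $ j * v j) = \<rho> * v i"
    by (rule distinguished_eigenvalue_onE) (rule that)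
  have "0 < v i" if "i \<in> class_of A c" for i
    by (rule class_eigenvector_positive[OF assms v(4,5,2,3) that])
  with v(1) show thesis
    using v(5) by (rule that)
qed

text \<open>A left eigenvector is a right eigenvector of the transpose, which has the same classes. Its
  equation is stated in the form in which it is used, namely paired with an arbitrary vector.\<close>

lemma class_left_eigenvector:
  fixes A :: "real^'n^'n"
  assumes "nonneg_matrix A"
  obtains u \<rho> where "\<And>i. i \<in> class_of A c \<Longrightarrow> 0 < u i"
    "\<And>x. (\<Sum>i\<in>class_of A c. u i * (\<Sum>j\<in>class_of A c. A $ i $ j * x j))
        = \<rho> * (\<Sum>i\<in>class_of A c. u i * x i)"
proof -
  let ?S = "class_of A c"
  have "nonneg_matrix (transpose A)"
    using assms by (simp add: nonneg_matrix_def transpose_def)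
  then obtain u \<rho> where u: "\<And>i. i \<in> ?S \<Longrightarrow> 0 < u i"
    "\<And>j. j \<in> ?S \<Longrightarrow> (\<Sum>i\<in>?S. transpose A $ j $ i * u i) = \<rho> * u j"
    by (rule class_positive_eigenvector[of "transpose A" c, unfolded class_of_transpose]) (rule that)
  have "(\<Sum>i\<in>?S. u i * (\<Sum>j\<in>?S. A $ i $ j * x j)) = \<rho> * (\<Sum>i\<in>?S. u i * x i)" for x
  proof -
    have "(\<Sum>i\<in>?S. u i * (\<Sum>j\<in>?S. A $ i $ j * x j)) = (\<Sum>i\<in>?S. \<Sum>j\<in>?S. A $ i $ j * u i * x j)"
      by (simp add: sum_distrib_left mult_ac)
    also have "\<dots> = (\<Sum>j\<in>?S. \<Sum>i\<in>?S. A $ i $ j * u i * x j)" by (rule sum.swap)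
    also have "\<dots> = (\<Sum>j\<in>?S. \<rho> * u j * x j)"
      using u(2) by (intro sum.cong) (simp_all add: transpose_def flip: sum_distrib_right)
    finally show ?thesis by (simp add: sum_distrib_left mult_ac)
  qed
  with u(1) show thesis by (rule that)
qed

lemma weighted_sum_pos:
  fixes u x :: "'a \<Rightarrow> real"
  assumes "finite S" "\<And>i. i \<in> S \<Longrightarrow> 0 < u i" "\<And>i. i \<in> S \<Longrightarrow> 0 \<le> x i" "j \<in> S" "x j \<noteq> 0"
  shows "0 < (\<Sum>i\<in>S. u i * x i)"
proof (rule sum_pos2[OF assms(1,4)])
  show "0 < u j * x j" using assms(2)[of j] assms(3)[of j] assms(4,5) by simp
  show "\<And>i. i \<in> S \<Longrightarrow> 0 \<le> u i * x i" using assms(2,3) by (simp add: less_imp_le)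
qed

text \<open>Pairing with a positive left eigenvector shows that all nonnegative eigenvectors of the block
  have the same eigenvalue, so the maximum in the definition of the Perron root ranges over a
  single value.\<close>

lemma node_root_eqI:
  fixes A :: "real^'n^'n"
  assumes A: "nonneg_matrix A" and "distinguished_eigenvalue_on (class_of A c) A \<rho>"
  shows "node_root A c = \<rho>"
proof -
  let ?S = "class_of A c"
  obtain u \<rho>' where u: "\<And>i. i \<in> ?S \<Longrightarrow> 0 < u i"
    "\<And>x. (\<Sum>i\<in>?S. u i * (\<Sum>j\<in>?S. A $ i $ j * x j)) = \<rho>' * (\<Sum>i\<in>?S. u i * x i)"
    by (rule class_left_eigenvector[OF A, of c]) (rule that)
  have eq: "\<sigma> = \<rho>'" if "distinguished_eigenvalue_on ?S A \<sigma>" for \<sigma>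
  proof -
    obtain v j where v: "j \<in> ?S" "v j \<noteq> 0" "\<And>i. i \<in> ?S \<Longrightarrow> 0 \<le> v i"
      "\<And>i. i \<in> ?S \<Longrightarrow> (\<Sum>j\<in>?S. A $ i $ j * v j) = \<sigma> * v i"
      using \<open>distinguished_eigenvalue_on ?S A \<sigma>\<close> by (rule distinguished_eigenvalue_onE) (rule that)
    have "\<rho>' * (\<Sum>i\<in>?S. u i * v i) = (\<Sum>i\<in>?S. u i * (\<sigma> * v i))"
      using v(4) by (simp flip: u(2))
    also have "\<dots> = \<sigma> * (\<Sum>i\<in>?S. u i * v i)"
      by (simp add: sum_distrib_left mult_ac)
    finally show ?thesis
      using weighted_sum_pos[of ?S u v j] u(1) v by simp
  qed
  have "(GREATEST \<sigma>. distinguished_eigenvalue_on ?S A \<sigma>) = \<rho>"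
    using assms(2) eq by (intro Greatest_equality) (auto dest: eq)
  then show ?thesis
    by (simp add: node_root_def class_perron_root_def perron_root_on_def)
qed

lemma class_perron_vector:
  fixes A :: "real^'n^'n"
  assumes "nonneg_matrix A"
  obtains v where "\<And>i. i \<in> class_of A c \<Longrightarrow> 0 < v i"
    "\<And>i. i \<in> class_of A c \<Longrightarrow> (\<Sum>j\<in>class_of A c. A $ i $ j * v j) = node_root A c * v i"
    "0 \<le> node_root A c"
proof -
  obtain v \<rho> where v: "0 \<le> \<rho>" "\<And>i. i \<in> class_of A c \<Longrightarrow> 0 < v i"
    "\<And>i. i \<in> class_of A c \<Longrightarrow> (\<Sum>j\<in>class_of A c. A $ i $ j * v j) = \<rho> * v i"
    by (rule class_positive_eigenvector[OF assms, of c]) (rule that)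
  have "v c \<noteq> 0" using v(2)[of c] by simp
  then have "distinguished_eigenvalue_on (class_of A c) A \<rho>"
    unfolding distinguished_eigenvalue_on_def
    using v by (intro conjI exI[of _ v] bexI[of _ c]) (auto simp: less_imp_le)
  from node_root_eqI[OF assms this] v show thesis by (intro that[of v]) auto
qed

lemma node_root_nonneg:
  assumes "nonneg_matrix A"
  shows "0 \<le> node_root A c"
  by (rule class_perron_vector[OF assms, of c])

text \<open>Pairing the left eigenvector with the right Perron vector identifies its eigenvalue as the
  Perron root.\<close>

lemma class_left_perron_vector:
  fixes A :: "real^'n^'n"
  assumes "nonneg_matrix A"
  obtains u where "\<And>i. i \<in> class_of A c \<Longrightarrow> 0 < u i"
    "\<And>x. (\<Sum>i\<in>class_of A c. u i * (\<Sum>j\<in>class_of A c. A $ i $ j * x j))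
        = node_root A c * (\<Sum>i\<in>class_of A c. u i * x i)"
proof -
  let ?S = "class_of A c"
  obtain u \<rho> where u: "\<And>i. i \<in> ?S \<Longrightarrow> 0 < u i"
    "\<And>x. (\<Sum>i\<in>?S. u i * (\<Sum>j\<in>?S. A $ i $ j * x j)) = \<rho> * (\<Sum>i\<in>?S. u i * x i)"
    by (rule class_left_eigenvector[OF assms, of c]) (rule that)
  obtain v where v: "\<And>i. i \<in> ?S \<Longrightarrow> 0 < v i"
    "\<And>i. i \<in> ?S \<Longrightarrow> (\<Sum>j\<in>?S. A $ i $ j * v j) = node_root A c * v i"
    by (rule class_perron_vector[OF assms, of c]) (rule that)
  have "\<rho> * (\<Sum>i\<in>?S. u i * v i) = (\<Sum>i\<in>?S. u i * (node_root A c * v i))"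
    using v(2) by (simp flip: u(2))
  also have "\<dots> = node_root A c * (\<Sum>i\<in>?S. u i * v i)"
    by (simp add: sum_distrib_left mult_ac)
  finally have "\<rho> = node_root A c"
    using weighted_sum_pos[of ?S u v c] u(1) v(1) class_of_self[of c A]
    by (simp add: less_imp_le less_imp_neq[symmetric])
  with u show thesis by (intro that[of u]) auto
qed

section \<open>Matrices commuting with a matrix whose class roots are distinct\<close>

definition distinct_class_roots :: "real^'n^'n \<Rightarrow> bool" where
  "distinct_class_roots A \<longleftrightarrow> inj_on (class_perron_root A) (classes A)"

lemma class_of_eq_if_node_root_eq:
  "distinct_class_roots A \<Longrightarrow> node_root A i = node_root A j \<Longrightarrow> class_of A i = class_of A j"
  by (auto simp: distinct_class_roots_def inj_on_def node_root_def classes_eq_range)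

text \<open>Call an arc of \<open>B\<close> bad if it is no path of \<open>A\<close>. For a minimal bad arc \<open>(s, t)\<close>
  the off-diagonal summands of \<open>(A B)\<^sub>i\<^sub>j\<close> and \<open>(B A)\<^sub>i\<^sub>j\<close>, for \<open>i\<close> in the class of \<open>s\<close> and \<open>j\<close> in the class of \<open>t\<close>, vanish: a nonzero one would produce a
  bad arc that starts later or ends earlier. What remains intertwines the two diagonal
  blocks of \<open>A\<close>.\<close>

lemma commuting_arc_reaches:
  fixes A B :: "real^'n^'n"
  assumes A: "nonneg_matrix A" and B: "nonneg_matrix B" and dist: "distinct_class_roots A"
    and comm: "A ** B = B ** A" and arc: "0 < B $ i $ j"
  shows "reaches A i j"
proof (rule ccontr)
  define Bad where "Bad = {(i, j). 0 < B $ i $ j \<and> \<not> reaches A i j}"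
  \<comment> \<open>Small when \<open>i\<close> reaches few nodes (late) and \<open>j\<close> is reached from few nodes (early).\<close>
  define m where "m = (\<lambda>(i, j). card {l. reaches A i l} + card {l. reaches A l j})"
  assume "\<not> reaches A i j"
  then have "Bad \<noteq> {}" using arc by (auto simp: Bad_def)
  then obtain p where p: "is_arg_min m (\<lambda>p. p \<in> Bad) p"
    using ex_is_arg_min_if_finite[of Bad m] by auto
  obtain s t where st: "p = (s, t)" by (cases p)
  have "(s, t) \<in> Bad" using p unfolding st is_arg_min_def by blast
  then have bad: "0 < B $ s $ t" "\<not> reaches A s t" by (simp_all add: Bad_def)
  have min: "m (s, t) \<le> m (k, l)" if "0 < B $ k $ l" "\<not> reaches A k l" for k l
  proof -
    have "(k, l) \<in> Bad" using that by (simp add: Bad_def)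
    then have "\<not> m (k, l) < m (s, t)" using p unfolding st is_arg_min_def by blast
    then show ?thesis by simp
  qed
  let ?S = "class_of A s" and ?T = "class_of A t"
  have card_S: "{l. reaches A k l} = {l. reaches A s l}" if "k \<in> ?S" for k
    using that unfolding class_of_def by (blast intro: reaches_trans)
  have card_T: "{l. reaches A l k} = {l. reaches A l t}" if "k \<in> ?T" for k
    using that unfolding class_of_def by (blast intro: reaches_trans)
  have not_ST: "\<not> reaches A k l" if "k \<in> ?S" "l \<in> ?T" for k l
    using that bad(2) unfolding class_of_def by (blast intro: reaches_trans)
  have block: "(\<Sum>k\<in>?S. A $ i $ k * B $ k $ j) = (\<Sum>k\<in>?T. B $ i $ k * A $ k $ j)"
    if ij: "i \<in> ?S" "j \<in> ?T" for i j
  proof -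
    have 1: "A $ i $ k * B $ k $ j = 0" if k: "k \<notin> ?S" for k
    proof (rule ccontr)
      assume "A $ i $ k * B $ k $ j \<noteq> 0"
      then have pos: "0 < A $ i $ k" "0 < B $ k $ j"
        using A B by (auto simp: nonneg_matrix_def order_less_le)
      have "reaches A i k" by (rule reaches_arc) fact
      then have nkj: "\<not> reaches A k j" using not_ST[OF ij] reaches_trans by blast
      have "reaches A s k" "\<not> reaches A k s"
        using k \<open>reaches A i k\<close> ij(1) unfolding class_of_def by (auto intro: reaches_trans)
      from card_reaches_less[OF this] min[OF pos(2) nkj] show False
        using card_T[OF ij(2)] by (simp add: m_def)
    qed
    have 2: "B $ i $ k * A $ k $ j = 0" if k: "k \<notin> ?T" for k
    proof (rule ccontr)
      assume "B $ i $ k * A $ k $ j \<noteq> 0"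
      then have pos: "0 < B $ i $ k" "0 < A $ k $ j"
        using A B by (auto simp: nonneg_matrix_def order_less_le)
      have "reaches A k j" by (rule reaches_arc) fact
      then have nik: "\<not> reaches A i k" using not_ST[OF ij] reaches_trans by blast
      have "reaches A k t" "\<not> reaches A t k"
        using k \<open>reaches A k j\<close> ij(2) unfolding class_of_def by (auto intro: reaches_trans)
      from card_reached_less[OF this] min[OF pos(1) nik] show False
        using card_S[OF ij(1)] by (simp add: m_def)
    qed
    have "(\<Sum>k\<in>?S. A $ i $ k * B $ k $ j) = (A ** B) $ i $ j"
      by (simp add: matrix_matrix_mult_def) (rule sum.mono_neutral_left; use 1 in auto)
    also have "\<dots> = (\<Sum>k\<in>?T. B $ i $ k * A $ k $ j)"
      unfolding comm by (simp add: matrix_matrix_mult_def) (rule sum.mono_neutral_right; use 2 in auto)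
    finally show ?thesis .
  qed
  obtain v where v: "\<And>i. i \<in> ?T \<Longrightarrow> 0 < v i"
    "\<And>i. i \<in> ?T \<Longrightarrow> (\<Sum>j\<in>?T. A $ i $ j * v j) = node_root A t * v i"
    by (rule class_perron_vector[OF A, of t]) (rule that)
  \<comment> \<open>The image of the Perron vector of the class of \<open>t\<close> under the block of \<open>B\<close>.\<close>
  define y where "y k = (\<Sum>j\<in>?T. B $ k $ j * v j)" for k
  have y_nonneg: "0 \<le> y k" for k
    unfolding y_def using B v(1) by (intro sum_nonneg) (auto simp: nonneg_matrix_def less_imp_le)
  have "0 < B $ s $ t * v t" using bad(1) v(1) by simp
  also have "\<dots> \<le> y s"
    unfolding y_def using B v(1)
    by (intro member_le_sum) (auto simp: nonneg_matrix_def less_imp_le)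
  finally have y_s: "y s \<noteq> 0" by simp
  have "(\<Sum>k\<in>?S. A $ i $ k * y k) = node_root A t * y i" if i: "i \<in> ?S" for i
  proof -
    have "(\<Sum>k\<in>?S. A $ i $ k * y k) = (\<Sum>k\<in>?S. \<Sum>j\<in>?T. A $ i $ k * B $ k $ j * v j)"
      by (simp add: y_def sum_distrib_left mult_ac)
    also have "\<dots> = (\<Sum>j\<in>?T. (\<Sum>k\<in>?S. A $ i $ k * B $ k $ j) * v j)"
      by (subst sum.swap) (simp add: sum_distrib_right)
    also have "\<dots> = (\<Sum>j\<in>?T. \<Sum>k\<in>?T. B $ i $ k * A $ k $ j * v j)"
      by (intro sum.cong) (simp_all add: block[OF i] sum_distrib_right)
    also have "\<dots> = (\<Sum>k\<in>?T. B $ i $ k * (\<Sum>j\<in>?T. A $ k $ j * v j))"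
      by (subst sum.swap) (simp add: sum_distrib_left mult_ac)
    also have "\<dots> = (\<Sum>k\<in>?T. B $ i $ k * (node_root A t * v k))"
      by (intro sum.cong) (simp_all add: v(2))
    also have "\<dots> = node_root A t * y i"
      by (simp add: y_def sum_distrib_left mult_ac)
    finally show ?thesis .
  qed
  then have "distinguished_eigenvalue_on ?S A (node_root A t)"
    unfolding distinguished_eigenvalue_on_def
    using y_nonneg y_s node_root_nonneg[OF A]
    by (intro conjI exI[of _ y]) (auto intro: bexI[of _ s])
  then have "node_root A s = node_root A t" by (rule node_root_eqI[OF A])
  then have "class_of A s = class_of A t"
    by (rule class_of_eq_if_node_root_eq[OF dist])
  then show False
    using bad(2) by (simp add: class_of_eq_iff)
qed

lemma commuting_same_reaches:
  fixes A B :: "real^'n^'n"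
  assumes "nonneg_matrix A" "nonneg_matrix B" "distinct_class_roots A" "A ** B = B ** A"
    and "reaches B i j"
  shows "reaches A i j"
  using assms(5)
proof (induction rule: reaches_converse_induct)
  case (step i k)
  then show ?case using commuting_arc_reaches[OF assms(1-4)] reaches_trans by blast
qed simp

section \<open>Nonnegative eigenvectors and premier spectral classes\<close>

text \<open>The two alternatives in the definition of a spectral class are absorbed by the strict
  inequality: if the root is positive, the inequality implies the second one, and if it is zero, no
  nonnegative root is smaller, so the class is initial.\<close>

lemma class_of_premier_iff:
  fixes A :: "real^'n^'n"
  assumes "nonneg_matrix A"
  shows "class_of A j \<in> premier_spectral_classes A \<longleftrightarrow>
    (\<forall>i. reaches A i j \<longrightarrow> \<not> reaches A j i \<longrightarrow> node_root A i < node_root A j)"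
proof -
  have *: "(\<forall>\<mu>\<in>classes A. accesses A \<mu> (class_of A j) \<longrightarrow> P \<mu>) \<longleftrightarrow>
      (\<forall>i. reaches A i j \<longrightarrow> P (class_of A i))" for P
    by (auto simp: classes_eq_range accesses_class_of)
  have **: "class_of A i = class_of A j \<longleftrightarrow> reaches A j i" if "reaches A i j" for i
    using that by (simp add: class_of_eq_iff)
  have strict: "(\<forall>\<mu>\<in>classes A. accesses A \<mu> (class_of A j) \<and> \<mu> \<noteq> class_of A j
        \<longrightarrow> class_perron_root A \<mu> < class_perron_root A (class_of A j)) \<longleftrightarrow>
      (\<forall>i. reaches A i j \<longrightarrow> \<not> reaches A j i \<longrightarrow> node_root A i < node_root A j)"
    using *[of "\<lambda>\<mu>. \<mu> \<noteq> class_of A j \<longrightarrow>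
        class_perron_root A \<mu> < class_perron_root A (class_of A j)"] **
    by (auto simp: node_root_def)
  have spectral: "spectral_class A (class_of A j)"
    if less: "\<And>i. reaches A i j \<Longrightarrow> \<not> reaches A j i \<Longrightarrow> node_root A i < node_root A j"
  proof (cases "0 < node_root A j")
    case True
    have "node_root A i \<le> node_root A j" if "reaches A i j" for i
      using less[OF that] ** [OF that] by (cases "reaches A j i") (auto simp: node_root_def)
    then show ?thesis
      using True *[of "\<lambda>\<mu>. class_perron_root A \<mu> \<le> class_perron_root A (class_of A j)"]
      by (simp add: spectral_class_def node_root_def classes_eq_range)
  next
    case False
    have "class_of A i = class_of A j" if "reaches A i j" for i
    proof -
      have "reaches A j i"
        using less[OF that] False node_root_nonneg[OF assms, of i] by linarith
      with that show ?thesis by (simp add: class_of_eq_iff)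
    qed
    then have "\<forall>\<mu>\<in>classes A. accesses A \<mu> (class_of A j) \<longrightarrow> \<mu> = class_of A j"
      unfolding * by blast
    then show ?thesis
      by (simp add: spectral_class_def initial_class_def classes_eq_range)
  qed
  show ?thesis
    unfolding premier_spectral_classes_def mem_Collect_eq strict using spectral by blast
qed

lemma premier_class_representative:
  assumes "\<mu> \<in> premier_spectral_classes A"
  obtains j where "\<mu> = class_of A j"
  using assms by (auto simp: premier_spectral_classes_def spectral_class_def classes_eq_range)

lemma nonneg_eigenvector_support_closed:
  fixes A :: "real^'n^'n"
  assumes A: "nonneg_matrix A" and v: "\<And>i. 0 \<le> v $ i" "A *v v = l *s v"
    and "reaches A i j" "0 < v $ j"
  shows "0 < v $ i"
  using assms(4)
proof (induction rule: reaches_converse_induct)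
  case base
  show ?case by fact
next
  case (step i k)
  have "0 < A $ i $ k * v $ k" using step by simp
  also have "\<dots> \<le> (\<Sum>j\<in>UNIV. A $ i $ j * v $ j)"
    using A v(1) by (intro member_le_sum) (auto simp: nonneg_matrix_def)
  also have "\<dots> = l * v $ i"
    using v(2) by (simp add: vec_eq_iff matrix_vector_mult_def)
  finally show ?case
    using v(1)[of i] by (cases "v $ i = 0") auto
qed

text \<open>Write \<open>e\<close> for the part of \<open>A v\<close> on a class that comes from outside the class, \<open>\<alpha>\<close> for its
  root and \<open>u\<close> for its left Perron vector. Pairing the eigenvalue equation with \<open>u\<close> gives
  \<open>\<alpha> \<langle>u, v\<rangle> + \<langle>u, e\<rangle> = l \<langle>u, v\<rangle>\<close>, so \<open>\<alpha> \<le> l\<close>, with equality iff \<open>e = 0\<close>, that is, iff no path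
  leads from the class to another part of the support.\<close>

lemma node_root_on_support:
  fixes A :: "real^'n^'n"
  assumes A: "nonneg_matrix A" and v: "\<And>i. 0 \<le> v $ i" "A *v v = l *s v"
    and c: "0 < v $ c"
  shows "node_root A c \<le> l"
    and "node_root A c = l \<longleftrightarrow> (\<forall>k. 0 < v $ k \<longrightarrow> reaches A c k \<longrightarrow> reaches A k c)"
proof -
  let ?S = "class_of A c"
  obtain u where u: "\<And>i. i \<in> ?S \<Longrightarrow> 0 < u i"
    "\<And>x. (\<Sum>i\<in>?S. u i * (\<Sum>j\<in>?S. A $ i $ j * x j)) = node_root A c * (\<Sum>i\<in>?S. u i * x i)"
    by (rule class_left_perron_vector[OF A, of c]) (rule that)
  define e where "e i = (\<Sum>k\<in>- ?S. A $ i $ k * v $ k)" for i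
  have e_nonneg: "0 \<le> e i" for i
    unfolding e_def using A v(1) by (intro sum_nonneg) (auto simp: nonneg_matrix_def)
  have row: "(\<Sum>k\<in>?S. A $ i $ k * v $ k) + e i = l * v $ i" for i
  proof -
    have "(\<Sum>k\<in>?S. A $ i $ k * v $ k) + e i = (\<Sum>k\<in>UNIV. A $ i $ k * v $ k)"
      unfolding e_def by (subst sum.union_disjoint[symmetric]) auto
    then show ?thesis
      using v(2) by (simp add: vec_eq_iff matrix_vector_mult_def)
  qed
  let ?w = "\<Sum>i\<in>?S. u i * v $ i"
  have w_pos: "0 < ?w"
    using weighted_sum_pos[of ?S u "\<lambda>i. v $ i" c] u(1) v(1) c by simp
  have balance: "node_root A c * ?w + (\<Sum>i\<in>?S. u i * e i) = l * ?w"
  proof -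
    have "node_root A c * ?w + (\<Sum>i\<in>?S. u i * e i)
        = (\<Sum>i\<in>?S. u i * ((\<Sum>k\<in>?S. A $ i $ k * v $ k) + e i))"
      by (simp add: u(2)[symmetric] distrib_left sum.distrib)
    also have "\<dots> = (\<Sum>i\<in>?S. u i * (l * v $ i))" by (simp only: row)
    also have "\<dots> = l * ?w" by (simp add: sum_distrib_left mult_ac)
    finally show ?thesis .
  qed
  have leak_nonneg: "0 \<le> u i * e i" if "i \<in> ?S" for i
    using u(1)[OF that] e_nonneg[of i] by simp
  then have "0 \<le> (\<Sum>i\<in>?S. u i * e i)" by (rule sum_nonneg)
  with balance have "node_root A c * ?w \<le> l * ?w" by linarith
  then show "node_root A c \<le> l" using w_pos by simp
  have u_neq: "u i \<noteq> 0" if "i \<in> ?S" for i using u(1)[OF that] by simp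
  have "node_root A c = l \<longleftrightarrow> (\<Sum>i\<in>?S. u i * e i) = 0"
    using balance w_pos by auto
  also have "\<dots> \<longleftrightarrow> (\<forall>i\<in>?S. e i = 0)"
    using leak_nonneg u_neq by (subst sum_nonneg_eq_0_iff) auto
  also have "\<dots> \<longleftrightarrow> (\<forall>k. 0 < v $ k \<longrightarrow> reaches A c k \<longrightarrow> reaches A k c)"
  proof
    assume e0: "\<forall>i\<in>?S. e i = 0"
    have "i \<in> ?S \<longrightarrow> k \<in> ?S" if "reaches A i k" "0 < v $ k" for i k
      using that
    proof (induction rule: reaches_converse_induct)
      case (step i m)
      show ?case
      proof
        assume i: "i \<in> ?S"
        have "0 < v $ m"
          using nonneg_eigenvector_support_closed[OF A v step.hyps(2) \<open>0 < v $ k\<close>] .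
        then have "A $ i $ m * v $ m \<noteq> 0" using step.hyps(1) by simp
        moreover have "A $ i $ m * v $ m = 0" if "m \<notin> ?S"
          using e0 i that A v(1) unfolding e_def
          by (subst (asm) sum_nonneg_eq_0_iff) (auto simp: nonneg_matrix_def)
        ultimately show "k \<in> ?S" using step.IH \<open>0 < v $ k\<close> by blast
      qed
    qed simp
    then show "\<forall>k. 0 < v $ k \<longrightarrow> reaches A c k \<longrightarrow> reaches A k c"
      using class_of_self[of c A] by (auto simp: class_of_def)
  next
    assume last: "\<forall>k. 0 < v $ k \<longrightarrow> reaches A c k \<longrightarrow> reaches A k c"
    show "\<forall>i\<in>?S. e i = 0"
      unfolding e_def
    proof (intro ballI sum.neutral)
      fix i k assume i: "i \<in> ?S" and k: "k \<in> - ?S"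
      show "A $ i $ k * v $ k = 0"
      proof (rule ccontr)
        assume "A $ i $ k * v $ k \<noteq> 0"
        then have "0 < A $ i $ k" "0 < v $ k"
          using A v(1) by (auto simp: nonneg_matrix_def order_less_le)
        then have "reaches A c k"
          using i reaches_arc[of A i k] unfolding class_of_def by (blast intro: reaches_trans)
        with last \<open>0 < v $ k\<close> k show False by (simp add: class_of_def)
      qed
    qed
  qed
  finally show "node_root A c = l \<longleftrightarrow> (\<forall>k. 0 < v $ k \<longrightarrow> reaches A c k \<longrightarrow> reaches A k c)" .
qed

text \<open>Within such a support the class of \<open>j\<close> is the only one from which no path leads to another class
  of the support, so its root is \<open>l\<close> and all other roots are smaller.\<close>

lemma premier_if_support_is_access_set:
  fixes A :: "real^'n^'n"
  assumes A: "nonneg_matrix A" and v: "\<And>i. 0 \<le> v $ i" "A *v v = l *s v"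
    and supp: "\<And>i. 0 < v $ i \<longleftrightarrow> reaches A i j"
  shows "class_of A j \<in> premier_spectral_classes A" "node_root A j = l"
proof -
  show root: "node_root A j = l"
    using node_root_on_support(2)[OF A v, of j] by (simp add: supp)
  have "node_root A i < l" if "reaches A i j" "\<not> reaches A j i" for i
  proof -
    have "0 < v $ i" using that(1) supp by simp
    then have "node_root A i \<le> l" "node_root A i \<noteq> l"
      using node_root_on_support[OF A v, of i] that unfolding supp by (simp, auto)
    then show ?thesis by simp
  qed
  then show "class_of A j \<in> premier_spectral_classes A"
    by (simp add: class_of_premier_iff[OF A] root)
qed

text \<open>Every class of the support leads to one that comes last in it. The roots of all last classes equal
  \<open>l\<close>, so by distinctness there is only one of them, and the whole support has access to it.\<close>

lemma nonneg_eigenvector_premier: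
  fixes A :: "real^'n^'n"
  assumes A: "nonneg_matrix A" and dist: "distinct_class_roots A"
    and v: "\<And>i. 0 \<le> v $ i" "A *v v = l *s v" and "v \<noteq> 0"
  obtains j where "class_of A j \<in> premier_spectral_classes A" "node_root A j = l"
    "\<And>i. 0 < v $ i \<longleftrightarrow> reaches A i j"
proof -
  define S where "S = {i. 0 < v $ i}"
  have last_root: "node_root A k = l"
    if "k \<in> S" "\<forall>m\<in>S. reaches A k m \<longrightarrow> reaches A m k" for k
    using node_root_on_support(2)[OF A v, of k] that by (auto simp: S_def)
  have "S \<noteq> {}"
    using \<open>v \<noteq> 0\<close> v(1) by (auto simp: S_def vec_eq_iff order_less_le)
  then obtain j where j: "j \<in> S" "\<forall>k\<in>S. reaches A j k \<longrightarrow> reaches A k j"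
    using last_node_exists[of S A] by blast
  have "reaches A i j" if "i \<in> S" for i
  proof -
    have "{k \<in> S. reaches A i k} \<noteq> {}" using that reaches_refl by blast
    then obtain k where k: "k \<in> S" "reaches A i k"
      and k_last: "\<forall>m\<in>{m \<in> S. reaches A i m}. reaches A k m \<longrightarrow> reaches A m k"
      using last_node_exists[of "{k \<in> S. reaches A i k}" A] by blast
    have "\<forall>m\<in>S. reaches A k m \<longrightarrow> reaches A m k"
      using k(2) k_last by (auto intro: reaches_trans)
    then have "node_root A k = node_root A j"
      using last_root[OF k(1)] last_root[OF j] by simp
    then have "reaches A k j"
      using class_of_eq_if_node_root_eq[OF dist, of k j] by (simp add: class_of_eq_iff)
    with k(2) show ?thesis by (rule reaches_trans)
  qed
  moreover have "i \<in> S" if "reaches A i j" for i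
    using nonneg_eigenvector_support_closed[OF A v that] j(1) by (simp add: S_def)
  ultimately have supp: "0 < v $ i \<longleftrightarrow> reaches A i j" for i
    by (auto simp: S_def)
  show thesis
    by (rule that[OF premier_if_support_is_access_set[OF A v supp] supp])
qed

text \<open>All nonzero nonnegative eigenvectors for \<open>l\<close> have the same support. Subtracting from \<open>w\<close> the largest
  multiple of \<open>v\<close> that keeps the difference nonnegative creates a zero in this support, so the
  difference is zero.\<close>

lemma nonneg_eigenvector_unique:
  fixes A :: "real^'n^'n"
  assumes A: "nonneg_matrix A" and dist: "distinct_class_roots A"
    and v: "\<And>i. 0 \<le> v $ i" "A *v v = l *s v" "v \<noteq> 0"
    and w: "\<And>i. 0 \<le> w $ i" "A *v w = l *s w"
  obtains t where "0 \<le> t" "w = t *s v"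
proof -
  obtain j where j: "node_root A j = l" "\<And>i. 0 < v $ i \<longleftrightarrow> reaches A i j"
    by (rule nonneg_eigenvector_premier[OF A dist v]) (rule that)
  have full: "\<And>i. 0 < x $ i \<longleftrightarrow> reaches A i j"
    if x: "\<And>i. 0 \<le> x $ i" "A *v x = l *s x" "x \<noteq> 0" for x
  proof -
    obtain k where k: "node_root A k = l" "\<And>i. 0 < x $ i \<longleftrightarrow> reaches A i k"
      by (rule nonneg_eigenvector_premier[OF A dist x]) (rule that)
    have "class_of A k = class_of A j"
      using j(1) k(1) by (intro class_of_eq_if_node_root_eq[OF dist]) simp
    then have "reaches A k j" "reaches A j k" by (simp_all add: class_of_eq_iff)
    then show "\<And>i. 0 < x $ i \<longleftrightarrow> reaches A i j"
      unfolding k(2) by (blast intro: reaches_trans)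
  qed
  define S where "S = {i. reaches A i j}"
  \<comment> \<open>The smallest quotient over the support is the largest admissible multiple of \<open>v\<close>.\<close>
  define q where "q i = w $ i / v $ i" for i
  have "j \<in> S" by (simp add: S_def)
  then have "S \<noteq> {}" by blast
  then obtain m where m: "m \<in> S" "\<And>i. i \<in> S \<Longrightarrow> q m \<le> q i"
    using ex_is_arg_min_if_finite[of S q] by (force simp: is_arg_min_linorder)
  have v_pos: "0 < v $ i \<longleftrightarrow> i \<in> S" for i using j(2) by (simp add: S_def)
  have "0 \<le> q m" unfolding q_def using v(1) w(1) by simp
  define y where "y = w - q m *s v"
  have "0 \<le> y $ i" for i
  proof (cases "i \<in> S")
    case True
    then have "q m * v $ i \<le> q i * v $ i"
      using m(2) v(1) by (simp add: mult_right_mono)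
    also have "\<dots> = w $ i" using True v_pos[of i] by (simp add: q_def)
    finally show ?thesis by (simp add: y_def)
  next
    case False
    then have "v $ i = 0" using v_pos[of i] v(1)[of i] by simp
    then show ?thesis using w(1) by (simp add: y_def)
  qed
  moreover have "A *v y = l *s y"
    using v(2) w(2)
    by (simp add: y_def matrix_vector_mult_diff_distrib vector_scalar_commute vec_eq_iff algebra_simps)
  moreover have "y $ m = 0"
    using m(1) v_pos[of m] by (simp add: y_def q_def)
  ultimately have "y = 0"
    using full[of y m] m(1) by (auto simp: S_def)
  then show thesis
    using that[of "q m"] \<open>0 \<le> q m\<close> by (simp add: y_def)
qed

text \<open>A maximum principle. The negative part \<open>y\<close> of \<open>x\<close> satisfies \<open>l y \<le> A y\<close> on its support. On a
  class that comes last in this support the matrix acts as a diagonal block, and pairing with the left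
  Perron vector shows that the root of this class is at least \<open>l\<close>.\<close>

lemma superharmonic_nonneg:
  fixes A :: "real^'n^'n"
  assumes A: "nonneg_matrix A"
    and root: "\<And>i. i \<in> T \<Longrightarrow> node_root A i < l"
    and out: "\<And>i. i \<notin> T \<Longrightarrow> x $ i = 0"
    and super: "\<And>i. i \<in> T \<Longrightarrow> (A *v x) $ i \<le> l * x $ i"
  shows "0 \<le> x $ i"
proof (rule ccontr)
  define y where "y i = max 0 (- x $ i)" for i
  assume "\<not> 0 \<le> x $ i"
  then have "{i. 0 < y i} \<noteq> {}" by (auto simp: y_def intro: exI[of _ i])
  then obtain c where c: "0 < y c" "\<forall>k. 0 < y k \<longrightarrow> reaches A c k \<longrightarrow> reaches A k c"
    using last_node_exists[of "{i. 0 < y i}" A] by auto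
  have y_nonneg: "0 \<le> y i" for i by (simp add: y_def)
  have y_T: "i \<in> T" "x $ i = - y i" if "0 < y i" for i
    using that out[of i] by (auto simp: y_def max_def split: if_splits)
  let ?S = "class_of A c"
  have sub: "l * y i \<le> (\<Sum>k\<in>?S. A $ i $ k * y k)" if i: "i \<in> ?S" for i
  proof (cases "0 < y i")
    case False
    then have "y i = 0" using y_nonneg[of i] by simp
    then show ?thesis
      using A y_nonneg by (simp add: nonneg_matrix_def sum_nonneg)
  next
    case True
    have "l * y i = - (l * x $ i)" using y_T(2)[OF True] by simp
    also have "\<dots> \<le> - (A *v x) $ i" using super[OF y_T(1)[OF True]] by simp
    also have "\<dots> = (\<Sum>k\<in>UNIV. A $ i $ k * - x $ k)"
      by (simp add: matrix_vector_mult_def sum_negf)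
    also have "\<dots> \<le> (\<Sum>k\<in>UNIV. A $ i $ k * y k)"
      using A by (intro sum_mono mult_left_mono) (auto simp: nonneg_matrix_def y_def)
    also have "\<dots> = (\<Sum>k\<in>?S. A $ i $ k * y k)"
    proof (rule sum.mono_neutral_right)
      show "\<forall>k\<in>UNIV - ?S. A $ i $ k * y k = 0"
      proof (rule ballI, rule ccontr)
        fix k assume k: "k \<in> UNIV - ?S" "A $ i $ k * y k \<noteq> 0"
        then have "0 < A $ i $ k" "0 < y k"
          using A y_nonneg[of k] by (auto simp: nonneg_matrix_def order_less_le)
        moreover from this have "reaches A c k"
          using i reaches_arc[of A i k] unfolding class_of_def by (blast intro: reaches_trans)
        ultimately show False
          using c(2) k(1) by (auto simp: class_of_def)
      qed
    qed auto
    finally show ?thesis .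
  qed
  obtain u where u: "\<And>i. i \<in> ?S \<Longrightarrow> 0 < u i"
    "\<And>x. (\<Sum>i\<in>?S. u i * (\<Sum>j\<in>?S. A $ i $ j * x j)) = node_root A c * (\<Sum>i\<in>?S. u i * x i)"
    by (rule class_left_perron_vector[OF A, of c]) (rule that)
  have pos: "0 < (\<Sum>i\<in>?S. u i * y i)"
    using weighted_sum_pos[of ?S u y c] u(1) y_nonneg c(1) by simp
  have "l * (\<Sum>i\<in>?S. u i * y i) = (\<Sum>i\<in>?S. u i * (l * y i))"
    by (simp add: sum_distrib_left mult_ac)
  also have "\<dots> \<le> (\<Sum>i\<in>?S. u i * (\<Sum>j\<in>?S. A $ i $ j * y j))"
    using sub u(1) by (intro sum_mono mult_left_mono) (auto simp: less_imp_le)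
  also have "\<dots> = node_root A c * (\<Sum>i\<in>?S. u i * y i)" by (rule u(2))
  finally have "l \<le> node_root A c" using pos by simp
  then show False using root[OF y_T(1)[OF c(1)]] by simp
qed

text \<open>The eigenvector is the Perron vector \<open>q\<close> of the class, extended to the other nodes \<open>T\<close> with access
  to the class by the solution \<open>x\<close> of \<open>l x - A x = A q\<close> on \<open>T\<close>. Since all roots on \<open>T\<close> are smaller
  than \<open>l\<close>, the maximum principle makes this linear system injective, hence solvable, and its
  solution nonnegative.\<close>

lemma premier_class_eigenvector:
  fixes A :: "real^'n^'n"
  assumes A: "nonneg_matrix A" and prem: "class_of A j \<in> premier_spectral_classes A"
  obtains v where "\<And>i. 0 \<le> v $ i" "A *v v = node_root A j *s v" "v \<noteq> 0"
    "\<And>i. 0 < v $ i \<Longrightarrow> reaches A i j"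
proof -
  let ?S = "class_of A j" and ?l = "node_root A j"
  define T where "T = {i. reaches A i j \<and> \<not> reaches A j i}"
  have less: "node_root A i < ?l" if "i \<in> T" for i
    using prem that by (auto simp: class_of_premier_iff[OF A] T_def)
  obtain p where p: "\<And>i. i \<in> ?S \<Longrightarrow> 0 < p i"
    "\<And>i. i \<in> ?S \<Longrightarrow> (\<Sum>k\<in>?S. A $ i $ k * p k) = ?l * p i"
    by (rule class_perron_vector[OF A, of j]) (rule that)
  define q :: "real^'n" where "q = (\<chi> i. if i \<in> ?S then p i else 0)"
  \<comment> \<open>Off \<open>T\<close> the map is the identity, which forces the solution to vanish there.\<close>
  define L where "L x = (\<chi> i. if i \<in> T then ?l * x $ i - (A *v x) $ i else x $ i)" for x :: "real^'n"
  have "linear L"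
    by (rule linearI)
      (auto simp: L_def vec_eq_iff matrix_vector_right_distrib algebra_simps
        simp flip: scalar_mult_eq_scaleR simp: vector_scalar_commute)
  have L_nonneg: "0 \<le> x $ i" if "\<And>i. i \<notin> T \<Longrightarrow> L x $ i = 0" "\<And>i. 0 \<le> L x $ i" for x i
  proof (rule superharmonic_nonneg[OF A less])
    show "x $ i = 0" if "i \<notin> T" for i
      using \<open>\<And>i. i \<notin> T \<Longrightarrow> L x $ i = 0\<close>[OF that] that by (simp add: L_def)
    show "(A *v x) $ i \<le> ?l * x $ i" if "i \<in> T" for i
      using \<open>\<And>i. 0 \<le> L x $ i\<close>[of i] that by (simp add: L_def)
  qed
  \<comment> \<open>The maximum principle, applied to \<open>x\<close> and to \<open>- x\<close>.\<close>
  have "inj L"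
  proof (subst linear_injective_0[OF \<open>linear L\<close>], intro allI impI)
    fix x assume x: "L x = 0"
    then have "L (- x) = 0" by (simp add: linear_neg[OF \<open>linear L\<close>])
    with x have "0 \<le> x $ i \<and> 0 \<le> (- x) $ i" for i
      using L_nonneg[of x i] L_nonneg[of "- x" i] by simp
    then show "x = 0" by (simp add: vec_eq_iff order_antisym)
  qed
  with \<open>linear L\<close> have "surj L" by (rule linear_injective_imp_surjective) (rule refl)
  then obtain x where x: "(\<chi> i. if i \<in> T then (A *v q) $ i else 0) = L x"
    by (rule surjD[THEN exE]) (rule that)
  then have Lx: "L x $ i = (if i \<in> T then (A *v q) $ i else 0)" for i
    by (simp flip: x)
  have q_nonneg: "0 \<le> q $ i" for i using p(1)[of i] by (simp add: q_def less_imp_le)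
  have x_out: "x $ i = 0" if "i \<notin> T" for i using Lx[of i] that by (simp add: L_def)
  have x_nonneg: "0 \<le> x $ i" for i
    by (rule L_nonneg) (auto simp: Lx matrix_vector_mult_nonneg[OF A q_nonneg])
  define v where "v = x + q"
  have v_nonneg: "0 \<le> v $ i" for i using x_nonneg q_nonneg by (simp add: v_def)
  have v_supp: "reaches A i j" if "0 < v $ i" for i
    using that x_out[of i] by (auto simp: v_def q_def T_def class_of_def split: if_splits)
  have "(A *v v) $ i = ?l * v $ i" for i
  proof -
    consider "i \<in> T" | "i \<in> ?S" | "\<not> reaches A i j"
      by (auto simp: T_def class_of_def)
    then show ?thesis
    proof cases
      case 1
      then have "q $ i = 0" by (simp add: q_def T_def class_of_def)
      then show ?thesis
        using Lx[of i] 1 by (simp add: L_def v_def matrix_vector_right_distrib)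
    next
      case 2
      have "A $ i $ k * v $ k = 0" if k: "k \<notin> ?S" for k
      proof (rule ccontr)
        assume "A $ i $ k * v $ k \<noteq> 0"
        then have "0 < A $ i $ k" "0 < v $ k"
          using A v_nonneg by (auto simp: nonneg_matrix_def order_less_le)
        then have "reaches A k j" "reaches A j k"
          using v_supp 2 reaches_arc[of A i k] unfolding class_of_def by (auto intro: reaches_trans)
        with k show False by (simp add: class_of_def)
      qed
      then have "(A *v v) $ i = (\<Sum>k\<in>?S. A $ i $ k * v $ k)"
        unfolding matrix_vector_mult_def by (simp add: sum.mono_neutral_right[of UNIV ?S])
      also have "\<dots> = (\<Sum>k\<in>?S. A $ i $ k * p k)"
        using x_out by (intro sum.cong) (auto simp: v_def q_def T_def class_of_def)
      also have "\<dots> = ?l * v $ i"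
        using p(2)[OF 2] 2 x_out[of i] by (auto simp: v_def q_def T_def class_of_def)
      finally show ?thesis .
    next
      case 3
      have row: "A $ i $ k * v $ k = 0" for k
      proof (rule ccontr)
        assume "A $ i $ k * v $ k \<noteq> 0"
        then have "0 < A $ i $ k" "0 < v $ k"
          using A v_nonneg by (auto simp: nonneg_matrix_def order_less_le)
        then show False
          using v_supp 3 reaches_arc[of A i k] reaches_trans by blast
      qed
      have "v $ i = 0" using v_supp[of i] v_nonneg[of i] 3 by (auto simp: order_less_le)
      then show ?thesis by (simp only: matrix_vector_mult_def vec_lambda_beta row) simp
    qed
  qed
  then have "A *v v = ?l *s v" by (simp add: vec_eq_iff)
  moreover have "0 < v $ j"
    using p(1)[of j] x_nonneg[of j] by (simp add: v_def q_def add_nonneg_pos)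
  then have "v \<noteq> 0" by auto
  ultimately show thesis
    using v_nonneg v_supp by (intro that[of v]) auto
qed

section \<open>Common nonnegative eigenvectors of commuting matrices\<close>

text \<open>\<open>B v\<close> is again a nonnegative eigenvector of \<open>A\<close> for \<open>l\<close>, hence a multiple of \<open>v\<close>.\<close>

lemma commuting_eigenvector:
  fixes A B :: "real^'n^'n"
  assumes A: "nonneg_matrix A" and B: "nonneg_matrix B" and dist: "distinct_class_roots A"
    and comm: "A ** B = B ** A"
    and v: "\<And>i. 0 \<le> v $ i" "A *v v = l *s v" "v \<noteq> 0"
  obtains t where "0 \<le> t" "B *v v = t *s v"
proof -
  have "A *v (B *v v) = B *v (A *v v)"
    by (simp add: matrix_vector_mul_assoc comm)
  also have "\<dots> = l *s (B *v v)"
    by (simp add: v(2) vector_scalar_commute)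
  finally have "A *v (B *v v) = l *s (B *v v)" .
  then show thesis
    using nonneg_eigenvector_unique[OF A dist v matrix_vector_mult_nonneg[OF B v(1)]] that
    by blast
qed

text \<open>The eigenvector of \<open>A\<close> for the root of the class of \<open>j\<close> is also one of \<open>B\<close>. Its support consists of
  the nodes that reach \<open>j\<close>, for \<open>A\<close> and hence for \<open>B\<close>, and such a support determines the class and
  the root of \<open>B\<close> to which the vector belongs.\<close>

lemma common_premier_eigenvector:
  fixes A B :: "real^'n^'n"
  assumes A: "nonneg_matrix A" and B: "nonneg_matrix B" and dist: "distinct_class_roots A"
    and comm: "A ** B = B ** A" and same: "reaches A = reaches B"
    and v: "\<And>i. 0 \<le> v $ i" "A *v v = node_root A j *s v" "v \<noteq> 0"
  shows "class_of B j \<in> premier_spectral_classes B" "B *v v = node_root B j *s v"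
proof -
  obtain k where k: "node_root A k = node_root A j" "\<And>i. 0 < v $ i \<longleftrightarrow> reaches A i k"
    by (rule nonneg_eigenvector_premier[OF A dist v]) (rule that)
  have "class_of A k = class_of A j"
    by (rule class_of_eq_if_node_root_eq[OF dist k(1)])
  then have supp: "0 < v $ i \<longleftrightarrow> reaches B i j" for i
    unfolding k(2) same[symmetric] class_of_eq_iff by (blast intro: reaches_trans)
  obtain t where t: "B *v v = t *s v"
    using commuting_eigenvector[OF A B dist comm v] by blast
  show "class_of B j \<in> premier_spectral_classes B"
    by (rule premier_if_support_is_access_set(1)[OF B v(1) t supp])
  show "B *v v = node_root B j *s v"
    using t premier_if_support_is_access_set(2)[OF B v(1) t supp] by simp
qed

lemma premier_spectral_classes_commuting:
  fixes A B :: "real^'n^'n"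
  assumes A: "nonneg_matrix A" and B: "nonneg_matrix B" and dist: "distinct_class_roots A"
    and comm: "A ** B = B ** A" and same: "reaches A = reaches B"
  shows "premier_spectral_classes A \<subseteq> premier_spectral_classes B"
proof
  fix \<mu> assume \<mu>: "\<mu> \<in> premier_spectral_classes A"
  then obtain j where j: "\<mu> = class_of A j" by (rule premier_class_representative)
  obtain v where "\<And>i. 0 \<le> v $ i" "A *v v = node_root A j *s v" "v \<noteq> 0"
    by (rule premier_class_eigenvector[OF A \<mu>[unfolded j]]) (rule that)
  from common_premier_eigenvector(1)[OF assms this] show "\<mu> \<in> premier_spectral_classes B"
    using same_reaches_same_closure(1)[OF same] by (simp add: j)
qed

lemma distinguished_eigenvalues_eq:
  fixes A :: "real^'n^'n"
  assumes A: "nonneg_matrix A" and dist: "distinct_class_roots A"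
  shows "{\<rho>. distinguished_eigenvalue A \<rho>} = class_perron_root A ` premier_spectral_classes A"
proof (intro set_eqI iffI)
  fix \<rho> assume "\<rho> \<in> {\<rho>. distinguished_eigenvalue A \<rho>}"
  then obtain v where v: "\<And>i. 0 \<le> v $ i" "A *v v = \<rho> *s v" "v \<noteq> 0"
    by (auto simp: distinguished_eigenvalue_def)
  obtain j where "class_of A j \<in> premier_spectral_classes A" "node_root A j = \<rho>"
    by (rule nonneg_eigenvector_premier[OF A dist v]) (rule that)
  then show "\<rho> \<in> class_perron_root A ` premier_spectral_classes A"
    by (auto simp: node_root_def)
next
  fix \<rho> assume "\<rho> \<in> class_perron_root A ` premier_spectral_classes A"
  then obtain \<mu> where \<mu>: "\<mu> \<in> premier_spectral_classes A" "\<rho> = class_perron_root A \<mu>" by blast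
  obtain j where j: "\<mu> = class_of A j" using \<mu>(1) by (rule premier_class_representative)
  obtain v where "\<And>i. 0 \<le> v $ i" "A *v v = node_root A j *s v" "v \<noteq> 0"
    by (rule premier_class_eigenvector[OF A \<mu>(1)[unfolded j]]) (rule that)
  then show "\<rho> \<in> {\<rho>. distinguished_eigenvalue A \<rho>}"
    using node_root_nonneg[OF A, of j] unfolding distinguished_eigenvalue_def \<mu>(2) j
    by (auto simp: node_root_def)
qed

lemma card_distinguished_eigenvalues:
  fixes A :: "real^'n^'n"
  assumes "nonneg_matrix A" and "distinct_class_roots A"
  shows "card {\<rho>. distinguished_eigenvalue A \<rho>} = card (premier_spectral_classes A)"
proof -
  have "premier_spectral_classes A \<subseteq> classes A"
    by (auto simp: premier_spectral_classes_def spectral_class_def)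
  then have "inj_on (class_perron_root A) (premier_spectral_classes A)"
    using assms(2) unfolding distinct_class_roots_def by (rule inj_on_subset[rotated])
  then show ?thesis
    by (simp add: distinguished_eigenvalues_eq[OF assms] card_image)
qed

section \<open>Polynomials in commuting matrices\<close>

lemma matrix_power_eigenvector:
  fixes A :: "real^'n^'n"
  assumes "A *v v = l *s v"
  shows "matrix_power A k *v v = l ^ k *s v"
  by (induction k)
    (simp_all add: matrix_power_def assms vector_scalar_commute vector_smult_assoc mult.commute
      flip: matrix_vector_mul_assoc)

lemma matrix_monomial_eigenvector:
  fixes A :: "nat \<Rightarrow> real^'n^'n"
  assumes "\<And>i. i \<in> {1..r} \<Longrightarrow> A i *v v = x i *s v"
  shows "matrix_monomial r m A *v v = (\<Prod>i\<in>{1..r}. x i ^ Poly_Mapping.lookup m i) *s v"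
proof -
  let ?e = "Poly_Mapping.lookup m"
  have power: "matrix_power (A i) k *v v = x i ^ k *s v" if "i \<in> {1..r}" for i k
    by (rule matrix_power_eigenvector) (rule assms[OF that])
  have "foldr (\<lambda>i M. matrix_power (A i) (?e i) ** M) is (mat 1) *v v
      = prod_list (map (\<lambda>i. x i ^ ?e i) is) *s v" if "set is \<subseteq> {1..r}" for "is"
    using that
  proof (induction "is")
    case (Cons i "is")
    then have "i \<in> {1..r}" by simp
    with Cons show ?case
      by (simp add: power vector_scalar_commute vector_smult_assoc mult.commute
          flip: matrix_vector_mul_assoc)
  qed simp
  from this[of "[1..<Suc r]"] show ?thesis
    unfolding matrix_monomial_def
    by (simp add: prod.distinct_set_conv_list[symmetric] atLeastLessThanSuc_atLeastAtMost del: upt_Suc)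
qed

lemma poly_matrix_eigenvector:
  fixes A :: "nat \<Rightarrow> real^'n^'n"
  assumes "\<And>i. i \<in> {1..r} \<Longrightarrow> A i *v v = x i *s v"
  shows "poly_matrix r p A *v v = poly_value r p x *s v"
proof -
  have sum: "(\<Sum>m\<in>M. f m) *v v = (\<Sum>m\<in>M. f m *v v)" for f :: "_ \<Rightarrow> real^'n^'n" and M
    by (induction M rule: infinite_finite_induct) (simp_all add: matrix_vector_mult_add_rdistrib)
  have "poly_matrix r p A *v v
      = (\<Sum>m\<in>Poly_Mapping.keys p. Poly_Mapping.lookup p m *\<^sub>R (matrix_monomial r m A *v v))"
    by (simp add: poly_matrix_def sum flip: scaleR_matrix_vector_assoc)
  also have "\<dots> = (\<Sum>m\<in>Poly_Mapping.keys p.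
      (Poly_Mapping.lookup p m * (\<Prod>i\<in>{1..r}. x i ^ Poly_Mapping.lookup m i)) *s v)"
    by (simp only: matrix_monomial_eigenvector[OF assms] vector_smult_assoc
        flip: scalar_mult_eq_scaleR)
  also have "\<dots> = poly_value r p x *s v"
    by (simp only: poly_value_def scalar_mult_eq_scaleR scaleR_sum_left)
  finally show ?thesis .
qed

lemma commute_sum:
  fixes B :: "real^'n^'n"
  assumes "\<And>m. m \<in> M \<Longrightarrow> B ** f m = f m ** B"
  shows "B ** sum f M = sum f M ** B"
proof -
  have left: "B ** sum f M = (\<Sum>m\<in>M. B ** f m)"
    by (induction M rule: infinite_finite_induct) (simp_all add: matrix_add_ldistrib)
  have "(X + Y) ** B = X ** B + Y ** B" for X Y :: "real^'n^'n"
    by (simp add: matrix_matrix_mult_def vec_eq_iff distrib_right sum.distrib)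
  then have right: "sum f M ** B = (\<Sum>m\<in>M. f m ** B)"
    by (induction M rule: infinite_finite_induct) simp_all
  show ?thesis
    unfolding left right by (rule sum.cong[OF refl assms])
qed

lemma commute_poly_matrix:
  fixes A :: "nat \<Rightarrow> real^'n^'n" and B :: "real^'n^'n"
  assumes "\<And>i. i \<in> {1..r} \<Longrightarrow> B ** A i = A i ** B"
  shows "B ** poly_matrix r p A = poly_matrix r p A ** B"
proof -
  have prod: "B ** (M ** N) = (M ** N) ** B" if "B ** M = M ** B" "B ** N = N ** B"
    for M N :: "real^'n^'n"
    using that by (metis matrix_mul_assoc)
  have power: "B ** matrix_power M k = matrix_power M k ** B" if "B ** M = M ** B" for M k
    by (induction k) (simp_all add: matrix_power_def prod[OF that])
  have "B ** foldr (\<lambda>i M. matrix_power (A i) (e i) ** M) is (mat 1)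
      = foldr (\<lambda>i M. matrix_power (A i) (e i) ** M) is (mat 1) ** B"
    if "set is \<subseteq> {1..r}" for "is" e
    using that
  proof (induction "is")
    case (Cons i "is")
    then show ?case by (simp add: prod power assms)
  qed simp
  then have mono: "B ** matrix_monomial r m A = matrix_monomial r m A ** B" for m
    unfolding matrix_monomial_def by (simp add: atLeastLessThanSuc_atLeastAtMost del: upt_Suc)
  show ?thesis
    unfolding poly_matrix_def
  proof (rule commute_sum)
    fix m
    show "B ** (Poly_Mapping.lookup p m *\<^sub>R matrix_monomial r m A)
        = Poly_Mapping.lookup p m *\<^sub>R matrix_monomial r m A ** B"
      by (simp add: matrix_scalar_ac mono flip: scalar_matrix_assoc)
  qed
qed

text \<open>The nonnegative vectors of an eigenspace of \<open>P\<close> form a closed convex cone, which \<open>A\<close> maps into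
  itself.\<close>

lemma eigenspace_common_eigenvector:
  fixes A P :: "real^'n^'n"
  assumes A: "nonneg_matrix A" and comm: "A ** P = P ** A"
    and v: "\<And>i. 0 \<le> v $ i" "P *v v = \<rho> *s v" "v \<noteq> 0"
  obtains w l where "\<And>i. 0 \<le> w $ i" "P *v w = \<rho> *s w" "w \<noteq> 0" "A *v w = l *s w"
proof -
  define K where "K = {x :: real^'n. (\<forall>i. 0 \<le> x $ i) \<and> P *v x = \<rho> *s x}"
  have cl: "closed K"
    unfolding K_def scalar_mult_eq_scaleR
    by (intro closed_Collect_conj closed_Collect_all closed_Collect_le closed_Collect_eq
        continuous_intros linear_continuous_on matrix_vector_mul_bounded_linear)
  have add: "x + y \<in> K" if "x \<in> K" "y \<in> K" for x y
    using that by (simp add: K_def matrix_vector_right_distrib vector_add_ldistrib)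
  have scale: "c *s x \<in> K" if "0 \<le> c" "x \<in> K" for c x
    using that by (simp add: K_def vector_scalar_commute vector_smult_assoc mult.commute)
  have nonneg: "0 \<le> x $ i" if "x \<in> K" for x i
    using that by (simp add: K_def)
  have inv: "A *v x \<in> K" if "x \<in> K" for x
  proof -
    have "P *v (A *v x) = A *v (P *v x)"
      by (simp add: matrix_vector_mul_assoc comm)
    then show ?thesis
      using that matrix_vector_mult_nonneg[OF A, of x] by (simp add: K_def vector_scalar_commute)
  qed
  have vK: "v \<in> K" using v by (simp add: K_def)
  obtain w l where "w \<in> K" "w \<noteq> 0" "0 \<le> l" "A *v w = l *s w"
    using invariant_cone_eigenvector[OF cl add scale nonneg inv vK v(3)] by blast
  then show thesis by (intro that[of w l]) (auto simp: K_def)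
qed

section \<open>Commuting matrices with distinct class roots\<close>

theorem theorem4:
  fixes r :: nat and A :: "nat \<Rightarrow> real^'n^'n"
  assumes "1 \<le> r"
    and "\<forall>i\<in>{1..r}. nonneg_matrix (A i)"
    and "\<forall>i\<in>{1..r}. \<forall>j\<in>{1..r}. A i ** A j = A j ** A i"
    and "\<forall>i\<in>{1..r}. inj_on (class_perron_root (A i)) (classes (A i))"
  shows "(\<forall>i\<in>{1..r}. classes (A i) = classes (\<Sum>k\<in>{1..r}. A k)) \<and>
    (\<forall>i\<in>{1..r}. reduced_closure (A i) = reduced_closure (\<Sum>k\<in>{1..r}. A k)) \<and>
    ((\<forall>i\<in>{1..r}. \<forall>j\<in>{1..r}.
        premier_spectral_classes (A i) = premier_spectral_classes (A j)) \<and>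
     (\<forall>i\<in>{1..r}.
        premier_spectral_classes (A i) \<subseteq> premier_spectral_classes (\<Sum>k\<in>{1..r}. A k)) \<and>
     (\<forall>i\<in>{1..r}. \<forall>j\<in>{1..r}.
        card {\<rho>. distinguished_eigenvalue (A i) \<rho>} = card {\<rho>. distinguished_eigenvalue (A j) \<rho>})) \<and>
    (\<forall>i\<in>{1..r}. \<forall>p. polynomial_in r p \<and> nonneg_matrix (poly_matrix r p A) \<longrightarrow>
        {\<rho>. distinguished_eigenvalue (poly_matrix r p A) \<rho>} =
        (\<lambda>\<mu>. poly_value r p (\<lambda>k. class_perron_root (A k) \<mu>)) ` premier_spectral_classes (A i))"
proof -
  define C where "C = (\<Sum>k\<in>{1..r}. A k)"
  have nn: "nonneg_matrix (A i)" if "i \<in> {1..r}" for i using assms(2) that by blast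
  have comm: "A i ** A j = A j ** A i" if "i \<in> {1..r}" "j \<in> {1..r}" for i j
    using assms(3) that by blast
  have dist: "distinct_class_roots (A i)" if "i \<in> {1..r}" for i
    using assms(4) that by (simp add: distinct_class_roots_def)
  have C_entry: "C $ a $ b = (\<Sum>k\<in>{1..r}. A k $ a $ b)" for a b
    by (simp add: C_def)
  have C_nn: "nonneg_matrix C"
    using nn by (auto simp: nonneg_matrix_def C_entry intro!: sum_nonneg)
  have C_comm: "A i ** C = C ** A i" if i: "i \<in> {1..r}" for i
    unfolding C_def by (rule commute_sum) (rule comm[OF i])
  have reach_C: "reaches C = reaches (A i)" if i: "i \<in> {1..r}" for i
  proof (intro ext iffI)
    fix a b
    show "reaches (A i) a b" if "reaches C a b"
      by (rule commuting_same_reaches[OF nn[OF i] C_nn dist[OF i] C_comm[OF i] that])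
    show "reaches C a b" if "reaches (A i) a b"
      using that
    proof (induction rule: reaches_converse_induct)
      case (step a c)
      have "A i $ a $ c \<le> C $ a $ c"
        unfolding C_entry using nn by (intro member_le_sum[OF i]) (auto simp: nonneg_matrix_def)
      then have "reaches C a c" using step.hyps(1) by (intro reaches_arc) simp
      then show ?case using step.IH by (rule reaches_trans)
    qed simp
  qed
  have reach: "reaches (A i) = reaches (A j)" if "i \<in> {1..r}" "j \<in> {1..r}" for i j
    using reach_C[OF that(1)] reach_C[OF that(2)] by simp
  have prem_sub: "premier_spectral_classes (A i) \<subseteq> premier_spectral_classes (A j)"
    if "i \<in> {1..r}" "j \<in> {1..r}" for i j
    using that by (intro premier_spectral_classes_commuting nn dist comm reach)
  have prem: "premier_spectral_classes (A i) = premier_spectral_classes (A j)"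
    if "i \<in> {1..r}" "j \<in> {1..r}" for i j
    using prem_sub[OF that] prem_sub[OF that(2,1)] by blast
  have prem_C: "premier_spectral_classes (A i) \<subseteq> premier_spectral_classes C"
    if "i \<in> {1..r}" for i
    using that by (intro premier_spectral_classes_commuting nn dist C_nn C_comm reach_C[symmetric])
  have poly: "{\<rho>. distinguished_eigenvalue P \<rho>} =
      (\<lambda>\<mu>. poly_value r p (\<lambda>k. class_perron_root (A k) \<mu>)) ` premier_spectral_classes (A i)"
    if i: "i \<in> {1..r}" and P: "P = poly_matrix r p A" "nonneg_matrix P" for i p P
  proof -
    have P_eigen: "P *v v = poly_value r p (\<lambda>k. class_perron_root (A k) (class_of (A i) j)) *s v"
      if v: "\<And>a. 0 \<le> v $ a" "A i *v v = node_root (A i) j *s v" "v \<noteq> 0" for v j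
      unfolding P(1)
    proof (rule poly_matrix_eigenvector)
      fix k assume k: "k \<in> {1..r}"
      have "A k *v v = node_root (A k) j *s v"
        by (rule common_premier_eigenvector(2)[OF nn[OF i] nn[OF k] dist[OF i]
              comm[OF i k] reach[OF i k] v])
      then show "A k *v v = class_perron_root (A k) (class_of (A i) j) *s v"
        using same_reaches_same_closure(1)[OF reach[OF i k]] by (simp add: node_root_def)
    qed
    show ?thesis
    proof (intro set_eqI iffI)
      fix \<rho> assume "\<rho> \<in> {\<rho>. distinguished_eigenvalue P \<rho>}"
      then obtain v where v: "\<And>a. 0 \<le> v $ a" "P *v v = \<rho> *s v" "v \<noteq> 0"
        by (auto simp: distinguished_eigenvalue_def)
      have "A i ** P = P ** A i"
        unfolding P(1) by (rule commute_poly_matrix) (rule comm[OF i])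
      then obtain w l where w: "\<And>a. 0 \<le> w $ a" "P *v w = \<rho> *s w" "w \<noteq> 0" "A i *v w = l *s w"
        by (rule eigenspace_common_eigenvector[OF nn[OF i] _ v]) (rule that)
      obtain j where j: "class_of (A i) j \<in> premier_spectral_classes (A i)" "node_root (A i) j = l"
        by (rule nonneg_eigenvector_premier[OF nn[OF i] dist[OF i] w(1,4,3)]) (rule that)
      have "\<rho> *s w = poly_value r p (\<lambda>k. class_perron_root (A k) (class_of (A i) j)) *s w"
        using P_eigen[of w j] w j(2) by simp
      then have "\<rho> = poly_value r p (\<lambda>k. class_perron_root (A k) (class_of (A i) j))"
        using w(3) by (auto simp: vec_eq_iff)
      then show "\<rho> \<in> (\<lambda>\<mu>. poly_value r p (\<lambda>k. class_perron_root (A k) \<mu>)) `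
          premier_spectral_classes (A i)"
        using j(1) by blast
    next
      fix \<rho> assume "\<rho> \<in> (\<lambda>\<mu>. poly_value r p (\<lambda>k. class_perron_root (A k) \<mu>)) `
          premier_spectral_classes (A i)"
      then obtain \<mu> where \<mu>: "\<mu> \<in> premier_spectral_classes (A i)"
        "\<rho> = poly_value r p (\<lambda>k. class_perron_root (A k) \<mu>)" by blast
      obtain j where j: "\<mu> = class_of (A i) j" using \<mu>(1) by (rule premier_class_representative)
      obtain v where v: "\<And>a. 0 \<le> v $ a" "A i *v v = node_root (A i) j *s v" "v \<noteq> 0"
        by (rule premier_class_eigenvector[OF nn[OF i] \<mu>(1)[unfolded j]]) (rule that)
      have Pv: "P *v v = \<rho> *s v" unfolding \<mu>(2) j by (rule P_eigen[OF v])
      \<comment> \<open>The value of \<open>p\<close> is nonnegative because \<open>P v\<close> is.\<close>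
      obtain a where "v $ a \<noteq> 0" using v(3) by (auto simp: vec_eq_iff)
      then have "0 < v $ a" using v(1)[of a] by simp
      moreover have "0 \<le> \<rho> * v $ a"
        using matrix_vector_mult_nonneg[OF P(2) v(1), of a] by (simp add: Pv)
      ultimately have "0 \<le> \<rho>" by (simp add: zero_le_mult_iff)
      then show "\<rho> \<in> {\<rho>. distinguished_eigenvalue P \<rho>}"
        using v Pv by (auto simp: distinguished_eigenvalue_def)
    qed
  qed
  show ?thesis
    unfolding C_def[symmetric]
  proof (intro conjI ballI allI impI)
    fix i assume i: "i \<in> {1..r}"
    show "classes (A i) = classes C" "reduced_closure (A i) = reduced_closure C"
      using same_reaches_same_closure(2,3)[OF reach_C[OF i]] by simp_all
    show "premier_spectral_classes (A i) \<subseteq> premier_spectral_classes C" by (rule prem_C[OF i])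
    show "premier_spectral_classes (A i) = premier_spectral_classes (A j)" if "j \<in> {1..r}" for j
      by (rule prem[OF i that])
    show "card {\<rho>. distinguished_eigenvalue (A i) \<rho>} = card {\<rho>. distinguished_eigenvalue (A j) \<rho>}"
      if j: "j \<in> {1..r}" for j
      unfolding card_distinguished_eigenvalues[OF nn[OF i] dist[OF i]]
        card_distinguished_eigenvalues[OF nn[OF j] dist[OF j]] prem[OF i j] ..
    show "{\<rho>. distinguished_eigenvalue (poly_matrix r p A) \<rho>} =
        (\<lambda>\<mu>. poly_value r p (\<lambda>k. class_perron_root (A k) \<mu>)) ` premier_spectral_classes (A i)"
      if "polynomial_in r p \<and> nonneg_matrix (poly_matrix r p A)" for p
      using that by (intro poly[OF i refl]) simp
  qed
qed

end
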